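(* Let $\mathcal H$ be a real Hilbert space, let $r\geq 2$, let $V_1,\ldots,V_r\subseteq\mathcal H$ be closed affine subspaces and assume that $V:=\bigcap_{i=1}^r V_i\neq\emptyset$. Moreover, let $T:=\frac 1 r\sum_{i=1}^r P_{V_i}$. Then exactly one of the following two statements holds: (i) $\sum_{i=1}^r (V_i-V_i)^\perp$ is closed. Then $T^k$ converges linearly to $P_V$ and $$q=\frac{r-1}{r}\cos(V_1,\ldots,V_r)+\frac 1 r$$ is the smallest possible number, independent of $x$, in the set of all $q\in(0,1)$ such that $$\|T^k(x)-P_V(x)\|\leq q^k\|x-P_V(0)\|$$ for all $x\in\mathcal H$ and all $k=0,1,2,\ldots$, where $\cos(V_1,\ldots,V_r):=\cos(V_1-V_1,\ldots,V_r-V_r)$. (ii) $\sum_{i=1}^r (V_i-V_i)^\perp$ is not closed. Then $T^k$ converges arbitrarily slowly to $P_V$. Moreover, there is a dense affine subspace $Y\subseteq\mathcal H$ on which $T^k$ converges super-polynomially fast to $P_V$.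
   Context: $P_C$ denotes the metric projection onto a nonempty closed convex set $C\subseteq\mathcal H$. For a closed affine subspace $V_i$, $V_i-V_i=\{u-v\mid u,v\in V_i\}$ is the closed linear subspace parallel to it. For closed linear subspaces $M_1,\ldots,M_r$ of $\mathcal H$ with $M:=\bigcap_i M_i$, the Friedrichs number is $$\cos(M_1,\ldots,M_r):=\sup\left\{\frac{1}{r-1}\frac{\sum_{i\neq j}\langle x_i,x_j\rangle}{\sum_{i=1}^r\|x_i\|^2}\ \middle|\ x_i\in M_i\cap M^\perp \text{ and } \sum_{i=1}^r\|x_i\|^2\neq 0\right\},$$ where the sum over $i\neq j$ runs over ordered pairs. Let $T,T^\infty\colon\mathcal H\to\mathcal H$ be such that $T^k(x)\to T^\infty(x)$ for every $x\in\mathcal H$. - $T^k$ converges linearly to $T^\infty$ (in the case of affine subspaces) if there are $c>0$ and $q\in(0,1)$ such that $\|T^k(x)-T^\infty(x)\|\leq cq^k\|x-T^\infty(0)\|$ for all $x\in\mathcal H$ and all $k=0,1,2,\ldots$. - $T^k$ converges arbitrarily slowly to $T^\infty$ if for every sequence $\{a_k\}_{k=0}^\infty\subseteq(0,\infty)$ with $a_k\to 0$ there is $x\in\mathcal H$ such that $\|T^k(x)-T^\infty(x)\|\geq a_k$ for every $k=0,1,2,\ldots$. - $T^k$ converges super-polynomially fast to $T^\infty$ on a nonempty set $Y\subseteq\mathcal H$ if $\|T^k(x)-T^\infty(x)\|/k^{-\alpha}\to 0$ as $k\to\infty$ for all $\alpha>0$ and all $x\in Y$.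
   Formalization: The claim that q is the smallest admissible number is stated only when the V_i are not all equal; if V_1=…=V_r, the supremum defining the cosine is over an empty set and every q in (0,1) satisfies the estimate, so no smallest one exists. *)

theory Defs
  imports "HOL-Analysis.Analysis"
begin

(* The library's closest_point requires the class heine_borel, which would force
   finite dimension. *)
definition metric_proj :: "'a::{real_inner, complete_space} set \<Rightarrow> 'a \<Rightarrow> 'a" where
  "metric_proj C x = (THE p. p \<in> C \<and> (\<forall>y\<in>C. dist x p \<le> dist x y))"

(* The set V - V of differences; on sets, the symbol "-" is set-theoretic difference. *)
definition direction :: "'a::real_vector set \<Rightarrow> 'a set" where
  "direction V = {u - v | u v. u \<in> V \<and> v \<in> V}"

definition simultaneous_proj ::
    "nat \<Rightarrow> (nat \<Rightarrow> 'a::{real_inner, complete_space} set) \<Rightarrow> 'a \<Rightarrow> 'a" where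
  "simultaneous_proj r V x = (1 / real r) *\<^sub>R (\<Sum>i=1..r. metric_proj (V i) x)"

(* For r \<ge> 2 the set is bounded above by 1. It is empty exactly when all M i coincide;
   the value is then the unspecified real number Sup {}. *)
definition friedrichs_number :: "nat \<Rightarrow> (nat \<Rightarrow> 'a::real_inner set) \<Rightarrow> real" where
  "friedrichs_number r M =
     Sup {1 / (real r - 1) *
            ((\<Sum>i=1..r. \<Sum>j\<in>{1..r} - {i}. x i \<bullet> x j) / (\<Sum>i=1..r. (norm (x i))\<^sup>2)) | x.
          (\<forall>i\<in>{1..r}. x i \<in> M i \<inter> orthogonal_comp (\<Inter>j\<in>{1..r}. M j)) \<and>
          (\<Sum>i=1..r. (norm (x i))\<^sup>2) \<noteq> 0}"

definition iterates_converge ::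
    "('a::real_normed_vector \<Rightarrow> 'a) \<Rightarrow> ('a \<Rightarrow> 'a) \<Rightarrow> bool" where
  "iterates_converge T Tinf \<longleftrightarrow> (\<forall>x. (\<lambda>k. (T ^^ k) x) \<longlonglongrightarrow> Tinf x)"

(* The modes of convergence below are notions for operators whose iterates converge
   pointwise, so pointwise convergence is part of each of them. *)

definition converges_linearly ::
    "('a::real_normed_vector \<Rightarrow> 'a) \<Rightarrow> ('a \<Rightarrow> 'a) \<Rightarrow> bool" where
  "converges_linearly T Tinf \<longleftrightarrow> iterates_converge T Tinf \<and>
     (\<exists>c>0. \<exists>q. 0 < q \<and> q < 1 \<and>
        (\<forall>x k. norm ((T ^^ k) x - Tinf x) \<le> c * q ^ k * norm (x - Tinf 0)))"

definition converges_arbitrarily_slowly ::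
    "('a::real_normed_vector \<Rightarrow> 'a) \<Rightarrow> ('a \<Rightarrow> 'a) \<Rightarrow> bool" where
  "converges_arbitrarily_slowly T Tinf \<longleftrightarrow> iterates_converge T Tinf \<and>
     (\<forall>a :: nat \<Rightarrow> real. (\<forall>k. 0 < a k) \<and> a \<longlonglongrightarrow> 0 \<longrightarrow>
        (\<exists>x. \<forall>k. a k \<le> norm ((T ^^ k) x - Tinf x)))"

definition converges_super_polynomially_on ::
    "'a set \<Rightarrow> ('a::real_normed_vector \<Rightarrow> 'a) \<Rightarrow> ('a \<Rightarrow> 'a) \<Rightarrow> bool" where
  "converges_super_polynomially_on Y T Tinf \<longleftrightarrow> iterates_converge T Tinf \<and> Y \<noteq> {} \<and>
     (\<forall>\<alpha>>0. \<forall>x\<in>Y.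
        (\<lambda>k. norm ((T ^^ k) x - Tinf x) / real k powr (- \<alpha>)) \<longlonglongrightarrow> 0)"

definition linear_rates ::
    "('a::real_normed_vector \<Rightarrow> 'a) \<Rightarrow> ('a \<Rightarrow> 'a) \<Rightarrow> real set" where
  "linear_rates T Tinf =
     {q. 0 < q \<and> q < 1 \<and>
         (\<forall>x k. norm ((T ^^ k) x - Tinf x) \<le> q ^ k * norm (x - Tinf 0))}"

end

theory Submission
  imports Defs
begin

text \<open>
After a translation by a common point the sets \<open>V i\<close> become closed linear subspaces \<open>M i\<close>, and
\<open>T\<close> becomes the average \<open>L\<close> of the orthogonal projections onto them. This \<open>L\<close> is self-adjoint with
\<open>0 \<le> L \<le> 1\<close>, and its fixed space is \<open>\<Inter>i. M i\<close>. On the fixed space nothing moves, so everything is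
decided by the restriction of \<open>L\<close> to the orthogonal complement \<open>W\<close> of the fixed space, and there by
the single question whether the norm of this restriction is below 1. The basic tool is that the
moments \<open>(L ^^ n) x \<bullet> x\<close> are nonnegative and decrease in \<open>n\<close>.

\<^item> If the norm is 1, there are unit vectors of \<open>W\<close> that \<open>L\<close> almost fixes. Since 1 is not an eigenvalue on
  \<open>W\<close>, they can also be taken almost orthogonal to any finite set of vectors of \<open>W\<close>. Superposing
  infinitely many of them with geometric weights gives an orbit that stays above a prescribed null
  sequence (\<open>arbitrarily_slow_orbit\<close>).

\<^item> In every case the vectors with a rapidly decaying orbit are dense in \<open>W\<close>: applying operators
  \<open>1 - L ^^ m\<close> with large \<open>m\<close> to a vector hardly changes it, while each of them improves the decay of
  the orbit by a factor of order \<open>k powr (- 1 / 2)\<close> (\<open>rapid_orbit_dense\<close>).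

\<^item> The norm is below 1 iff \<open>S = (\<Sum>i. orthogonal_comp (M i))\<close> is closed (\<open>closed_complement_sum_iff\<close>). If it is
  below 1, a Neumann series writes every vector of \<open>W\<close> as \<open>z - L z\<close>, which lies in \<open>S\<close>; so \<open>S = W\<close>.
  If \<open>S\<close> is closed, then again \<open>S = W\<close>; but orbits that start in \<open>S\<close> decay at a fixed polynomial rate,
  and so there is no arbitrarily slow orbit in \<open>W\<close>.

\<^item> Finally, \<open>(r - 1) / r * c + 1 / r\<close>, where \<open>c\<close> is the Friedrichs number, is the supremum of
  \<open>(norm (\<Sum>i. x i))\<^sup>2 / (r * (\<Sum>i. (norm (x i))\<^sup>2))\<close> over \<open>x i \<in> M i \<inter> W\<close>. Up to the factor
  \<open>1 / r\<close> this is the squared norm of the summation operator \<open>A\<close>, whose adjoint is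
  \<open>y \<mapsto> (P i y)\<^sub>i\<close>, so that \<open>A A\<^sup>* = r L\<close> and the supremum is the norm of \<open>L\<close> on \<open>W\<close>
  (\<open>rate_le\<close>, \<open>contracts_rate\<close>).
\<close>

section \<open>Increments and projections in Hilbert space\<close>

lemma convergent_of_summable_increments:
  fixes s :: "nat \<Rightarrow> 'a::{real_normed_vector, complete_space}"
  assumes step: "\<And>n. norm (s (Suc n) - s n) \<le> g n" and g: "summable g"
  obtains l where "s \<longlonglongrightarrow> l" "norm (l - s 0) \<le> suminf g"
proof -
  have g0: "0 \<le> g n" for n
    using step[of n] norm_ge_zero order_trans by blast
  have tele: "norm (s n - s m) \<le> sum g {m..<n}" if "m \<le> n" for m n
    using that
  proof (induction rule: dec_induct)
    case base
    then show ?case by simp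
  next
    case (step n)
    have "norm (s (Suc n) - s m) \<le> norm (s (Suc n) - s n) + norm (s n - s m)"
      by (metis diff_add_cancel add_diff_eq norm_triangle_ineq)
    with step assms(1)[of n] show ?case by simp
  qed
  have "Cauchy s"
  proof (rule metric_CauchyI)
    fix e :: real
    assume "0 < e"
    then obtain N where N: "\<And>m n. N \<le> m \<Longrightarrow> norm (sum g {m..<n}) < e"
      using g unfolding summable_Cauchy by blast
    have "dist (s m) (s n) < e" if "N \<le> m" "m \<le> n" for m n
      using tele[OF that(2)] N[OF that(1), of n] by (simp add: dist_norm norm_minus_commute)
    then show "\<exists>M. \<forall>m\<ge>M. \<forall>n\<ge>M. dist (s m) (s n) < e"
      by (metis dist_commute nat_le_linear)
  qed
  then obtain l where l: "s \<longlonglongrightarrow> l"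
    using Cauchy_convergent_iff convergent_def by blast
  have "norm (s n - s 0) \<le> suminf g" for n
    using tele[of 0 n] sum_le_suminf[OF g, of "{0..<n}"] g0 by force
  then have "norm (l - s 0) \<le> suminf g"
    by (intro LIMSEQ_le_const2[OF tendsto_norm[OF tendsto_diff[OF l tendsto_const]]]) auto
  with l that show thesis by blast
qed

text \<open>
A sequence in \<open>M\<close> whose distances to \<open>x\<close> approach the infimum is Cauchy by the parallelogram
identity, because midpoints stay in \<open>M\<close>; minimality of its limit forces orthogonality.
\<close>

lemma closed_subspace_orthogonal_decomposition:
  fixes M :: "'a::{real_inner, complete_space} set"
  assumes M: "subspace M" "closed M"
  obtains p where "p \<in> M" "\<And>u. u \<in> M \<Longrightarrow> (x - p) \<bullet> u = 0"
proof -
  define D where "D = (\<lambda>y. (norm (x - y))\<^sup>2) ` M"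
  define d where "d = Inf D"
  have bdd: "bdd_below D"
    unfolding D_def by (intro bdd_belowI[of _ 0]) auto
  have ne: "D \<noteq> {}"
    using subspace_0[OF M(1)] by (auto simp: D_def)
  have dle: "d \<le> (norm (x - y))\<^sup>2" if "y \<in> M" for y
    unfolding d_def using that bdd by (intro cInf_lower) (auto simp: D_def)
  have "\<exists>y\<in>M. (norm (x - y))\<^sup>2 < d + 1 / Suc n" for n
  proof -
    have "\<exists>z\<in>D. z < d + 1 / Suc n"
      using cInf_less_iff[OF ne bdd, of "d + 1 / Suc n"] by (simp add: d_def)
    then show ?thesis by (auto simp: D_def)
  qed
  then obtain y where yM: "\<And>n. y n \<in> M" and y: "\<And>n. (norm (x - y n))\<^sup>2 < d + 1 / Suc n"
    by metis
  have close: "(norm (y n - y m))\<^sup>2 \<le> 2 / Suc n + 2 / Suc m" for n m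
  proof -
    have mid: "(1/2) *\<^sub>R (y n + y m) \<in> M"
      using M(1) yM by (simp add: subspace_add subspace_scale)
    have "(norm (y n - y m))\<^sup>2 =
        2 * (norm (x - y n))\<^sup>2 + 2 * (norm (x - y m))\<^sup>2 - 4 * (norm (x - (1/2) *\<^sub>R (y n + y m)))\<^sup>2"
      by (simp add: power2_norm_eq_inner inner_diff inner_add inner_commute algebra_simps)
    with y[of n] y[of m] dle[OF mid] show ?thesis by simp
  qed
  have "Cauchy y"
  proof (rule metric_CauchyI)
    fix e :: real
    assume "0 < e"
    then obtain N where N: "4 / e\<^sup>2 < real (Suc N)"
      using reals_Archimedean2 by (metis less_Suc_eq of_nat_less_iff order_less_trans)
    have "dist (y n) (y m) < e" if "N \<le> n" "N \<le> m" for n m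
    proof -
      have "2 / real (Suc n) + 2 / real (Suc m) \<le> 2 / real (Suc N) + 2 / real (Suc N)"
        using that by (intro add_mono divide_left_mono) auto
      also have "\<dots> = 4 / real (Suc N)" by simp
      also have "\<dots> < e\<^sup>2"
        using N \<open>0 < e\<close> by (simp add: divide_less_eq mult.commute)
      finally have "(norm (y n - y m))\<^sup>2 < e\<^sup>2"
        using close[of n m] by linarith
      then show ?thesis
        using \<open>0 < e\<close> by (simp add: dist_norm power2_less_imp_less)
    qed
    then show "\<exists>K. \<forall>m\<ge>K. \<forall>n\<ge>K. dist (y m) (y n) < e" by blast
  qed
  then obtain p where p: "y \<longlonglongrightarrow> p"
    using Cauchy_convergent_iff convergent_def by blast
  have pM: "p \<in> M"
    using closed_sequentially[OF M(2)] yM p by blast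
  have pd: "(norm (x - p))\<^sup>2 \<le> d"
  proof (rule LIMSEQ_le)
    show "(\<lambda>n. (norm (x - y n))\<^sup>2) \<longlonglongrightarrow> (norm (x - p))\<^sup>2"
      by (intro tendsto_intros p)
    have "(\<lambda>n. d + 1 / real (Suc n)) \<longlonglongrightarrow> d + 0"
      using LIMSEQ_inverse_real_of_nat by (intro tendsto_intros) (simp add: inverse_eq_divide)
    then show "(\<lambda>n. d + 1 / real (Suc n)) \<longlonglongrightarrow> d" by simp
    show "\<exists>N. \<forall>n\<ge>N. (norm (x - y n))\<^sup>2 \<le> d + 1 / real (Suc n)"
      using y less_imp_le by blast
  qed
  have "(x - p) \<bullet> u = 0" if u: "u \<in> M" for u
  proof (cases "u = 0")
    case False
    define t where "t = ((x - p) \<bullet> u) / (u \<bullet> u)"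
    have uu: "u \<bullet> u > 0" using False by simp
    have "p + t *\<^sub>R u \<in> M"
      using M(1) pM u by (simp add: subspace_add subspace_scale)
    then have "(norm (x - p))\<^sup>2 \<le> (norm (x - (p + t *\<^sub>R u)))\<^sup>2"
      using dle pd order_trans by blast
    also have "\<dots> = (norm (x - p))\<^sup>2 - 2 * t * ((x - p) \<bullet> u) + t\<^sup>2 * (u \<bullet> u)"
      unfolding power2_norm_eq_inner power2_eq_square[of t]
      by (simp add: inner_diff inner_add inner_commute algebra_simps)
    also have "\<dots> = (norm (x - p))\<^sup>2 - ((x - p) \<bullet> u)\<^sup>2 / (u \<bullet> u)"
      using uu by (simp add: t_def power2_eq_square field_simps)
    finally have "((x - p) \<bullet> u)\<^sup>2 / (u \<bullet> u) \<le> 0" by simp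
    then show ?thesis
      using uu by (simp add: divide_le_0_iff)
  qed simp
  with pM that show thesis by blast
qed

text \<open>
Pythagoras turns orthogonality into minimality, and also gives the uniqueness of the nearest point.
\<close>

lemma metric_proj_eqI:
  fixes x :: "'a::{real_inner, complete_space}"
  assumes p: "p \<in> C" and orth: "\<And>y. y \<in> C \<Longrightarrow> (x - p) \<bullet> (y - p) = 0"
  shows "metric_proj C x = p"
proof -
  have pyth: "(dist x y)\<^sup>2 = (dist x p)\<^sup>2 + (dist p y)\<^sup>2" if "y \<in> C" for y
  proof -
    have "(dist x y)\<^sup>2 = (dist x p)\<^sup>2 + (dist p y)\<^sup>2 - 2 * ((x - p) \<bullet> (y - p))"
      by (simp add: dist_norm power2_norm_eq_inner inner_diff inner_commute algebra_simps)
    with orth[OF that] show ?thesis by simp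
  qed
  show ?thesis
    unfolding metric_proj_def
  proof (rule the_equality)
    have "dist x p \<le> dist x y" if "y \<in> C" for y
      by (rule power2_le_imp_le) (simp_all add: pyth[OF that])
    with p show "p \<in> C \<and> (\<forall>y\<in>C. dist x p \<le> dist x y)" by blast
    fix z
    assume z: "z \<in> C \<and> (\<forall>y\<in>C. dist x z \<le> dist x y)"
    then have "(dist x z)\<^sup>2 \<le> (dist x p)\<^sup>2"
      using p by (auto intro!: power_mono)
    with pyth[of z] z have "(dist p z)\<^sup>2 \<le> 0" by linarith
    then show "z = p" by simp
  qed
qed

lemma
  fixes M :: "'a::{real_inner, complete_space} set"
  assumes "subspace M" "closed M"
  shows metric_proj_in: "metric_proj M x \<in> M"
    and metric_proj_orthogonal: "u \<in> M \<Longrightarrow> (x - metric_proj M x) \<bullet> u = 0"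
proof -
  obtain p where p: "p \<in> M" "\<And>u. u \<in> M \<Longrightarrow> (x - p) \<bullet> u = 0"
    using closed_subspace_orthogonal_decomposition[OF assms] by blast
  have "metric_proj M x = p"
    using p assms(1) by (intro metric_proj_eqI) (auto intro: subspace_diff)
  with p show "metric_proj M x \<in> M" "u \<in> M \<Longrightarrow> (x - metric_proj M x) \<bullet> u = 0"
    by auto
qed

lemma metric_proj_subspace_eqI:
  fixes M :: "'a::{real_inner, complete_space} set"
  assumes "subspace M" "p \<in> M" "\<And>u. u \<in> M \<Longrightarrow> (x - p) \<bullet> u = 0"
  shows "metric_proj M x = p"
  using assms by (intro metric_proj_eqI) (auto intro: subspace_diff)

lemma metric_proj_translation:
  fixes M :: "'a::{real_inner, complete_space} set"
  assumes M: "subspace M" "closed M"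
  shows "metric_proj ((+) v ` M) x = v + metric_proj M (x - v)"
proof (rule metric_proj_eqI)
  show "v + metric_proj M (x - v) \<in> (+) v ` M"
    using metric_proj_in[OF M] by blast
  fix y
  assume "y \<in> (+) v ` M"
  then obtain u where u: "u \<in> M" "y = v + u" by blast
  have "(x - v - metric_proj M (x - v)) \<bullet> (u - metric_proj M (x - v)) = 0"
    by (rule metric_proj_orthogonal[OF M subspace_diff[OF M(1) u(1) metric_proj_in[OF M]]])
  with u show "(x - (v + metric_proj M (x - v))) \<bullet> (y - (v + metric_proj M (x - v))) = 0"
    by (simp add: algebra_simps)
qed

lemma direction_affine:
  fixes V :: "'a::real_vector set"
  assumes "affine V" "v \<in> V"
  shows "subspace (direction V)" and "V = (+) v ` direction V"
proof -
  have sub: "subspace ((\<lambda>x. x - v) ` V)"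
    using affine_diffs_subspace_subtract[OF assms] by simp
  have "direction V = (\<lambda>x. x - v) ` V"
  proof
    show "(\<lambda>x. x - v) ` V \<subseteq> direction V"
      using assms(2) by (auto simp: direction_def)
    show "direction V \<subseteq> (\<lambda>x. x - v) ` V"
    proof
      fix d
      assume "d \<in> direction V"
      then obtain u w where uw: "u \<in> V" "w \<in> V" "d = u - w"
        by (auto simp: direction_def)
      have "(u - v) - (w - v) \<in> (\<lambda>x. x - v) ` V"
        by (rule subspace_diff[OF sub]) (use uw in auto)
      with uw show "d \<in> (\<lambda>x. x - v) ` V" by simp
    qed
  qed
  with sub show "subspace (direction V)" "V = (+) v ` direction V"
    by (auto simp: image_image)
qed

lemma closed_direction:
  fixes V :: "'a::real_normed_vector set"
  assumes "affine V" "v \<in> V" "closed V"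
  shows "closed (direction V)"
proof -
  have "(+) (- v) ` V = (+) (- v) ` ((+) v ` direction V)"
    by (rule arg_cong[OF direction_affine(2)[OF assms(1,2)]])
  then have "direction V = (+) (- v) ` V"
    by (simp add: image_image)
  then show ?thesis
    using closed_translation[OF assms(3), of "- v"] by argo
qed

section \<open>Powers of a positive contraction\<close>

text \<open>
The condition \<open>firm\<close> says \<open>L\<^sup>2 \<le> L\<close> as quadratic forms; for a self-adjoint operator it is equivalent to
\<open>0 \<le> L \<le> 1\<close>. Averages of orthogonal projections satisfy it, although they need not be
projections.
\<close>

locale positive_contraction =
  fixes L :: "'a::{real_inner, complete_space} \<Rightarrow> 'a"
  assumes linear: "linear L"
    and self_adjoint: "L x \<bullet> y = x \<bullet> L y"
    and firm: "L x \<bullet> L x \<le> L x \<bullet> x"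
begin

text \<open>
The part of the space on which the iteration does something: the complement of the fixed points.
\<close>

definition active :: "'a set" where
  "active = orthogonal_comp {x. L x = x}"

lemma active_iff: "y \<in> active \<longleftrightarrow> (\<forall>z. L z = z \<longrightarrow> z \<bullet> y = 0)"
  by (simp add: active_def orthogonal_comp_def orthogonal_def)

lemma subspace_active: "subspace active"
  unfolding active_def by (rule subspace_orthogonal_comp)

lemma linear_pow: "linear (L ^^ k)"
proof (induction k)
  case (Suc k)
  then show ?case
    using linear_compose[OF Suc linear] by (simp add: o_def)
qed (simp add: linear_ident)

lemma pow_diff: "(L ^^ k) (x - y) = (L ^^ k) x - (L ^^ k) y"
  by (rule linear_diff[OF linear_pow])

lemma pow_pow: "(L ^^ m) ((L ^^ n) x) = (L ^^ (m + n)) x"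
  by (simp add: funpow_add)

lemma pow_L: "(L ^^ k) (L x) = L ((L ^^ k) x)"
  by (simp add: funpow_swap1)

lemma pow_self_adjoint: "(L ^^ k) x \<bullet> y = x \<bullet> (L ^^ k) y"
proof (induction k arbitrary: x y)
  case (Suc k)
  have "(L ^^ Suc k) x \<bullet> y = x \<bullet> (L ^^ k) (L y)"
    by (simp add: self_adjoint Suc)
  then show ?case by (simp add: pow_L)
qed simp

lemma pow_active: "y \<in> active \<Longrightarrow> (L ^^ k) y \<in> active"
proof -
  have fixed: "(L ^^ k) z = z" if "L z = z" for z
    using that by (induction k) auto
  assume "y \<in> active"
  then show "(L ^^ k) y \<in> active"
    unfolding active_iff by (metis fixed pow_self_adjoint)
qed

lemma inner_L_nonneg: "0 \<le> L x \<bullet> x"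
  using firm[of x] inner_ge_zero order_trans by blast

lemma norm_L_le: "norm (L x) \<le> norm x"
proof (cases "norm (L x) = 0")
  case False
  have "norm (L x) * norm (L x) \<le> norm x * norm (L x)"
    using firm[of x] norm_cauchy_schwarz[of "L x" x]
    by (simp add: power2_norm_eq_inner[symmetric] power2_eq_square mult.commute)
  with False show ?thesis by simp
qed simp

lemma norm_pow_le: "norm ((L ^^ k) x) \<le> norm x"
  by (induction k) (auto intro: order_trans[OF norm_L_le])

lemma norm_pow_antimono: "m \<le> n \<Longrightarrow> norm ((L ^^ n) x) \<le> norm ((L ^^ m) x)"
  using norm_pow_le[of "n - m" "(L ^^ m) x"] by (simp add: pow_pow)

lemma inner_pow_double: "(L ^^ (2 * k)) x \<bullet> x = (norm ((L ^^ k) x))\<^sup>2"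
  by (simp add: mult_2 pow_pow[symmetric] pow_self_adjoint power2_norm_eq_inner)

lemma inner_pow_Suc_double: "(L ^^ Suc (2 * k)) x \<bullet> x = L ((L ^^ k) x) \<bullet> (L ^^ k) x"
proof -
  have "(L ^^ Suc (2 * k)) x = (L ^^ k) (L ((L ^^ k) x))"
    by (simp add: mult_2 pow_pow[symmetric] pow_L)
  then show ?thesis
    by (simp add: pow_self_adjoint)
qed

text \<open>
Even powers give squared norms; an odd power leaves one factor \<open>L\<close>, which is positive.
\<close>

lemma inner_pow_nonneg: "0 \<le> (L ^^ n) x \<bullet> x"
proof (cases "even n")
  case True
  then obtain k where "n = 2 * k" by blast
  then show ?thesis by (simp add: inner_pow_double)
next
  case False
  then obtain k where "n = Suc (2 * k)" by (metis oddE Suc_eq_plus1)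
  then show ?thesis using inner_pow_Suc_double inner_L_nonneg by presburger
qed

text \<open>
The moment form of \<open>0 \<le> L ^^ n * (1 - L)\<close>. For even exponents it comes from contractivity of \<open>L\<close>,
for odd ones it is \<open>firm\<close> at \<open>(L ^^ k) x\<close>.
\<close>

lemma inner_pow_decreasing: "(L ^^ Suc n) x \<bullet> x \<le> (L ^^ n) x \<bullet> x"
proof (cases "even n")
  case True
  then obtain k where n: "n = 2 * k" by blast
  have "L ((L ^^ k) x) \<bullet> (L ^^ k) x \<le> norm (L ((L ^^ k) x)) * norm ((L ^^ k) x)"
    by (rule norm_cauchy_schwarz)
  also have "\<dots> \<le> (norm ((L ^^ k) x))\<^sup>2"
    unfolding power2_eq_square by (intro mult_right_mono norm_L_le) simp
  finally show ?thesis
    unfolding n inner_pow_Suc_double inner_pow_double .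
next
  case False
  then obtain k where n: "n = Suc (2 * k)" by (metis oddE Suc_eq_plus1)
  have "(L ^^ Suc n) x \<bullet> x = (norm ((L ^^ Suc k) x))\<^sup>2"
    using inner_pow_double[of "Suc k" x] n by simp
  also have "\<dots> \<le> L ((L ^^ k) x) \<bullet> (L ^^ k) x"
    using firm by (simp add: power2_norm_eq_inner)
  also have "\<dots> = (L ^^ n) x \<bullet> x"
    unfolding n inner_pow_Suc_double ..
  finally show ?thesis .
qed

lemma inner_pow_antimono: "m \<le> n \<Longrightarrow> (L ^^ n) x \<bullet> x \<le> (L ^^ m) x \<bullet> x"
  by (rule lift_Suc_antimono_le[where f = "\<lambda>n. (L ^^ n) x \<bullet> x"]) (rule inner_pow_decreasing)

text \<open>
Since \<open>0 \<le> L ^^ m \<le> 1\<close>, also \<open>1 - L ^^ m\<close> is a contraction.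
\<close>

lemma norm_diff_pow_le: "norm (x - (L ^^ m) x) \<le> norm x"
proof -
  have "(norm (x - (L ^^ m) x))\<^sup>2 = (norm x)\<^sup>2 - 2 * ((L ^^ m) x \<bullet> x) + (L ^^ (2 * m)) x \<bullet> x"
    unfolding inner_pow_double by (simp add: power2_norm_eq_inner inner_diff inner_commute)
  also have "\<dots> \<le> (norm x)\<^sup>2"
    using inner_pow_antimono[of m "2 * m" x] inner_pow_nonneg[of m x] by simp
  finally show ?thesis
    by (rule power2_le_imp_le) simp
qed

text \<open>
Squared distances between iterates are second differences of the moments, which converge because
they decrease; hence the orbit is Cauchy.
\<close>

lemma pow_converges_to_fixed_point:
  obtains z where "(\<lambda>k. (L ^^ k) x) \<longlonglongrightarrow> z" "L z = z"
proof -
  define c where "c n = (L ^^ n) x \<bullet> x" for n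
  have "decseq c"
    unfolding c_def decseq_def using inner_pow_antimono by blast
  then obtain l where l: "c \<longlonglongrightarrow> l"
    using inner_pow_nonneg decseq_convergent[of c 0] unfolding c_def by metis
  have cl: "l \<le> c n" for n
    using \<open>decseq c\<close> l decseq_ge by blast
  have dist: "(norm ((L ^^ m) x - (L ^^ n) x))\<^sup>2 = c (2 * m) - 2 * c (m + n) + c (2 * n)" for m n
  proof -
    have "(L ^^ m) x \<bullet> (L ^^ n) x = c (m + n)"
      by (simp add: c_def pow_self_adjoint pow_pow inner_commute)
    then show ?thesis
      unfolding c_def inner_pow_double by (simp add: power2_norm_eq_inner inner_diff inner_commute)
  qed
  have "Cauchy (\<lambda>k. (L ^^ k) x)"
  proof (rule metric_CauchyI)
    fix e :: real
    assume "0 < e"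
    then have "eventually (\<lambda>n. c n < l + e\<^sup>2 / 2) sequentially"
      using l by (intro order_tendstoD) auto
    then obtain N where N: "\<And>n. N \<le> n \<Longrightarrow> c n < l + e\<^sup>2 / 2"
      by (auto simp: eventually_sequentially)
    have "dist ((L ^^ m) x) ((L ^^ n) x) < e" if "N \<le> m" "N \<le> n" for m n
    proof -
      have "(norm ((L ^^ m) x - (L ^^ n) x))\<^sup>2 < e\<^sup>2"
        using dist[of m n] cl[of "m + n"] N[of "2 * m"] N[of "2 * n"] that by linarith
      then show ?thesis
        using \<open>0 < e\<close> by (simp add: dist_norm power2_less_imp_less)
    qed
    then show "\<exists>M. \<forall>m\<ge>M. \<forall>n\<ge>M. dist ((L ^^ m) x) ((L ^^ n) x) < e" by blast
  qed
  then obtain z where z: "(\<lambda>k. (L ^^ k) x) \<longlonglongrightarrow> z"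
    using Cauchy_convergent_iff convergent_def by blast
  have "(\<lambda>k. L ((L ^^ k) x) - L z) \<longlonglongrightarrow> 0"
    using norm_L_le z[THEN LIM_zero]
    by (intro Lim_null_comparison[OF _ tendsto_norm_zero[OF z[THEN LIM_zero]]])
       (auto simp: linear_diff[OF linear, symmetric])
  then have "(\<lambda>k. (L ^^ Suc k) x) \<longlonglongrightarrow> L z"
    by (simp add: LIM_zero_iff)
  then have "L z = z"
    using z LIMSEQ_Suc LIMSEQ_unique by blast
  with z that show thesis by blast
qed

lemma closed_active: "closed active"
proof -
  have "active = (\<Inter>z\<in>{z. L z = z}. {y. z \<bullet> y = 0})"
    by (auto simp: active_iff)
  then show ?thesis
    by (simp add: closed_INT closed_hyperplane)
qed

lemma pow_active_tendsto_0:
  assumes "y \<in> active"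
  shows "(\<lambda>k. (L ^^ k) y) \<longlonglongrightarrow> 0"
proof -
  obtain z where z: "(\<lambda>k. (L ^^ k) y) \<longlonglongrightarrow> z" "L z = z"
    using pow_converges_to_fixed_point by blast
  have "z \<in> active"
    using closed_sequentially[OF closed_active _ z(1)] pow_active[OF assms] by blast
  then have "z = 0"
    using z(2) by (auto simp: active_iff)
  with z show ?thesis by simp
qed

text \<open>
For \<open>z = x - L x\<close> the moments \<open>(L ^^ j) z \<bullet> z\<close> decrease in \<open>j\<close>, and their sum telescopes to at most
\<open>(norm x)\<^sup>2\<close>. So the moment of order \<open>2 * k\<close>, which is the squared norm of \<open>(L ^^ k) z\<close>, is at most the
average of the first \<open>2 * k + 1\<close> moments.
\<close>

lemma norm_pow_increment_sq: "real (2 * k + 1) * (norm ((L ^^ k) (x - L x)))\<^sup>2 \<le> (norm x)\<^sup>2"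
proof -
  define z where "z = x - L x"
  have tele: "(L ^^ j) z \<bullet> z = (L ^^ j) z \<bullet> x - (L ^^ Suc j) z \<bullet> x" for j
    by (simp add: z_def inner_diff_right self_adjoint)
  have "real (2 * k + 1) * ((L ^^ (2 * k)) z \<bullet> z) = (\<Sum>j<2 * k + 1. (L ^^ (2 * k)) z \<bullet> z)"
    by simp
  also have "\<dots> \<le> (\<Sum>j<2 * k + 1. (L ^^ j) z \<bullet> z)"
    by (intro sum_mono inner_pow_antimono) auto
  also have "\<dots> = (\<Sum>j<2 * k + 1. (L ^^ j) z \<bullet> x - (L ^^ Suc j) z \<bullet> x)"
    using tele by (intro sum.cong) auto
  also have "\<dots> = z \<bullet> x - (L ^^ (2 * k + 1)) z \<bullet> x"
    by (subst sum_lessThan_telescope') simp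
  also have "\<dots> \<le> (norm x)\<^sup>2"
  proof -
    have "z \<bullet> x \<le> (norm x)\<^sup>2"
      using inner_L_nonneg[of x] by (simp add: z_def inner_diff power2_norm_eq_inner)
    moreover have "0 \<le> (L ^^ n) z \<bullet> x" for n
      using inner_pow_decreasing[of n x]
      by (simp add: z_def pow_diff inner_diff pow_L)
    ultimately show ?thesis
      using order_trans diff_left_mono by (metis (no_types, lifting) diff_zero)
  qed
  finally show ?thesis
    by (simp only: inner_pow_double z_def)
qed

lemma norm_pow_increment: "norm ((L ^^ k) (x - L x)) \<le> norm x / sqrt (2 * k + 1)"
proof -
  have "(sqrt (2 * k + 1) * norm ((L ^^ k) (x - L x)))\<^sup>2 \<le> (norm x)\<^sup>2"
    using norm_pow_increment_sq[of k x] by (simp add: power_mult_distrib add.commute)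
  then have "sqrt (2 * k + 1) * norm ((L ^^ k) (x - L x)) \<le> norm x"
    by (rule power2_le_imp_le) simp
  then show ?thesis
    by (simp add: pos_le_divide_eq mult.commute add_pos_nonneg)
qed


section \<open>Arbitrarily slow orbits\<close>

lemma norm_pow_diff_le: "norm ((L ^^ n) e - e) \<le> real n * norm (L e - e)"
proof (induction n)
  case (Suc n)
  have "norm ((L ^^ Suc n) e - e) \<le> norm ((L ^^ n) (L e - e)) + norm ((L ^^ n) e - e)"
    using norm_triangle_ineq[of "(L ^^ n) (L e - e)" "(L ^^ n) e - e"]
    by (simp add: pow_diff pow_L)
  also have "\<dots> \<le> norm (L e - e) + real n * norm (L e - e)"
    by (intro add_mono norm_pow_le Suc)
  finally show ?case by (simp add: algebra_simps)
qed simp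

definition contracts :: "real \<Rightarrow> bool" where
  "contracts \<rho> \<longleftrightarrow> (\<forall>y\<in>active. norm (L y) \<le> \<rho> * norm y)"

lemma contracts_pow:
  assumes "contracts \<rho>" "0 \<le> \<rho>" "y \<in> active"
  shows "norm ((L ^^ k) y) \<le> \<rho> ^ k * norm y"
proof (induction k)
  case (Suc k)
  have "norm ((L ^^ Suc k) y) \<le> \<rho> * norm ((L ^^ k) y)"
    using assms(1) pow_active[OF assms(3)] by (simp add: contracts_def)
  also have "\<dots> \<le> \<rho> * (\<rho> ^ k * norm y)"
    by (intro mult_left_mono Suc assms(2))
  finally show ?case by (simp add: mult.assoc)
qed simp

text \<open>
A unit vector \<open>e\<close> with \<open>norm (L e)\<close> close to 1 is almost fixed, because \<open>firm\<close> gives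
\<open>(norm (L e - e))\<^sup>2 \<le> 1 - (norm (L e))\<^sup>2\<close>.
\<close>

lemma almost_fixed_vector:
  assumes nogap: "\<And>\<rho>. \<rho> < 1 \<Longrightarrow> \<not> contracts \<rho>" and \<epsilon>: "0 < \<epsilon>"
  obtains e where "e \<in> active" "norm e = 1" "norm (L e - e) \<le> \<epsilon>"
proof -
  have "\<not> contracts (1 - \<epsilon>\<^sup>2 / 2)"
    using \<epsilon> by (intro nogap) simp
  then obtain y where y: "y \<in> active" "(1 - \<epsilon>\<^sup>2 / 2) * norm y < norm (L y)"
    by (auto simp: contracts_def not_le)
  have y0: "y \<noteq> 0"
    using y(2) linear_0[OF linear] by auto
  define e where "e = (1 / norm y) *\<^sub>R y"
  have e: "e \<in> active" "norm e = 1"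
    using y y0 subspace_active by (auto simp: e_def subspace_scale)
  have "L e = (1 / norm y) *\<^sub>R L y"
    by (simp add: e_def linear_scale[OF linear])
  then have big: "1 - \<epsilon>\<^sup>2 / 2 < norm (L e)"
    using y y0 by (simp add: field_simps)
  have "(norm (L e - e))\<^sup>2 = L e \<bullet> L e - 2 * (L e \<bullet> e) + 1"
    using e(2) by (simp add: power2_norm_eq_inner inner_diff inner_commute norm_eq_1)
  also have "\<dots> \<le> 1 - (norm (L e))\<^sup>2"
    using firm[of e] by (simp add: power2_norm_eq_inner)
  also have "\<dots> \<le> 2 * (1 - norm (L e))"
  proof -
    have "0 \<le> (1 - norm (L e))\<^sup>2" by simp
    then show ?thesis by (simp add: power2_eq_square algebra_simps)
  qed
  also have "\<dots> \<le> \<epsilon>\<^sup>2"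
    using big by simp
  finally have "norm (L e - e) \<le> \<epsilon>"
    by (rule power2_le_imp_le) (use \<epsilon> in simp)
  with e that show thesis by blast
qed

text \<open>
An almost fixed \<open>e\<close> has \<open>f \<bullet> e\<close> close to \<open>f \<bullet> (L ^^ n) e = (L ^^ n) f \<bullet> e\<close>, and \<open>(L ^^ n) f\<close> tends to 0 for \<open>f\<close>
in \<open>active\<close>. So it suffices to fix \<open>n\<close> for the finitely many \<open>f\<close> and then to choose \<open>e\<close> very close to
being fixed.
\<close>

lemma almost_fixed_almost_orthogonal_vector:
  assumes nogap: "\<And>\<rho>. \<rho> < 1 \<Longrightarrow> \<not> contracts \<rho>" and \<epsilon>: "0 < \<epsilon>"
    and F: "finite F" "F \<subseteq> active"
  obtains e where "e \<in> active" "norm e = 1" "norm (L e - e) \<le> \<epsilon>" "\<forall>f\<in>F. \<bar>f \<bullet> e\<bar> \<le> \<epsilon>"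
proof -
  have "eventually (\<lambda>n. norm ((L ^^ n) f) < \<epsilon> / 2) sequentially" if "f \<in> F" for f
  proof -
    have "f \<in> active" using that F(2) by blast
    then have "(\<lambda>n. norm ((L ^^ n) f)) \<longlonglongrightarrow> 0"
      by (intro tendsto_norm_zero pow_active_tendsto_0)
    then show ?thesis
      using \<epsilon> by (intro order_tendstoD(2)) auto
  qed
  then have "eventually (\<lambda>n. \<forall>f\<in>F. norm ((L ^^ n) f) < \<epsilon> / 2) sequentially"
    using F(1) by (simp add: eventually_ball_finite)
  then obtain n where n: "\<And>f. f \<in> F \<Longrightarrow> norm ((L ^^ n) f) < \<epsilon> / 2"
    unfolding eventually_sequentially by blast
  obtain B where B: "0 < B" "\<And>f. f \<in> F \<Longrightarrow> norm f \<le> B"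
    using finite_imp_bounded[OF F(1)] unfolding bounded_pos by blast
  define \<delta> where "\<delta> = min \<epsilon> (\<epsilon> / (2 * B * real (Suc n)))"
  have \<delta>: "0 < \<delta>" "\<delta> \<le> \<epsilon>" "B * (real n * \<delta>) \<le> \<epsilon> / 2"
  proof -
    show "0 < \<delta>" "\<delta> \<le> \<epsilon>" using \<epsilon> B by (auto simp: \<delta>_def)
    have "B * (real n * \<delta>) \<le> B * (real (Suc n) * \<delta>)"
      using \<open>0 < \<delta>\<close> B by (intro mult_left_mono mult_right_mono) auto
    also have "\<dots> \<le> B * (real (Suc n) * (\<epsilon> / (2 * B * real (Suc n))))"
      using B by (intro mult_left_mono) (auto simp: \<delta>_def)
    also have "\<dots> = \<epsilon> / 2"
      using B by (simp del: of_nat_Suc)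
    finally show "B * (real n * \<delta>) \<le> \<epsilon> / 2" .
  qed
  obtain e where e: "e \<in> active" "norm e = 1" "norm (L e - e) \<le> \<delta>"
    using almost_fixed_vector[OF nogap \<delta>(1)] by blast
  have "\<bar>f \<bullet> e\<bar> \<le> \<epsilon>" if f: "f \<in> F" for f
  proof -
    have "f \<bullet> e = (L ^^ n) f \<bullet> e - f \<bullet> ((L ^^ n) e - e)"
      by (simp add: pow_self_adjoint inner_diff_right)
    also have "\<bar>\<dots>\<bar> \<le> \<bar>(L ^^ n) f \<bullet> e\<bar> + \<bar>f \<bullet> ((L ^^ n) e - e)\<bar>"
      by (rule abs_triangle_ineq4)
    also have "\<dots> \<le> norm ((L ^^ n) f) * norm e + norm f * norm ((L ^^ n) e - e)"
      by (intro add_mono Cauchy_Schwarz_ineq2)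
    also have "\<dots> \<le> \<epsilon> / 2 * 1 + B * (real n * \<delta>)"
      using n[OF f] e(2) B(2)[OF f] B(1) \<epsilon>
        order_trans[OF norm_pow_diff_le[of n e] mult_left_mono[OF e(3), of "real n"]]
      by (intro add_mono mult_mono) auto
    also have "\<dots> \<le> \<epsilon>"
      using \<delta>(3) by simp
    finally show ?thesis .
  qed
  with e \<delta>(2) that show thesis by force
qed

text \<open>
A gliding hump. The orbit starts at \<open>x = (\<Sum>j. c j *\<^sub>R e j)\<close> with geometric weights \<open>c j\<close>. The unit
vector \<open>e j\<close> hardly moves during the first \<open>2 * K j\<close> steps and is almost orthogonal to the iterates of
all other \<open>e i\<close>. Testing \<open>(L ^^ (2 * k)) x\<close> against \<open>e j\<close> shows \<open>c j / 2 \<le> norm ((L ^^ k) x)\<close> up to time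
\<open>K j\<close>, and \<open>K j\<close> is so large that afterwards \<open>a\<close> stays below half the next weight.
\<close>

theorem arbitrarily_slow_orbit:
  assumes nogap: "\<And>\<rho>. \<rho> < 1 \<Longrightarrow> \<not> contracts \<rho>" and a: "a \<longlonglongrightarrow> (0::real)"
  obtains x where "x \<in> active" "\<And>k. a k \<le> norm ((L ^^ k) x)"
proof -
  obtain B where B: "0 < B" "\<And>k. \<bar>a k\<bar> \<le> B"
    using convergent_imp_Bseq[OF convergentI[OF a]] by (auto simp: Bseq_def)
  define c where "c j = 2 * B * (1/2) ^ j" for j :: nat
  have c: "0 < c j" for j using B by (simp add: c_def)
  have "\<exists>N. \<forall>k\<ge>N. a k \<le> c (Suc j) / 2" for j
  proof -
    have "eventually (\<lambda>k. a k < c (Suc j) / 2) sequentially"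
      using a c[of "Suc j"] by (intro order_tendstoD) auto
    then show ?thesis
      unfolding eventually_sequentially using less_imp_le by blast
  qed
  then obtain N where N: "\<And>j k. N j \<le> k \<Longrightarrow> a k \<le> c (Suc j) / 2"
    by metis
  define K where "K j = (\<Sum>i\<le>j. N i + 1)" for j
  have K_mono: "K i \<le> K j" if "i \<le> j" for i j
    unfolding K_def using that by (intro sum_mono2) auto
  have K_N: "N j \<le> K j" for j
    unfolding K_def using member_le_sum[of j "{..j}" "\<lambda>i. N i + 1"] by simp
  have K_gt: "j < K j" for j
    unfolding K_def using sum_mono[of "{..j}" "\<lambda>_. 1" "\<lambda>i. N i + 1"] by simp
  \<comment> \<open>One tolerance for two purposes: the drift of e j over 2 * K j steps stays below 1/8, and the
    interference of e j with the earlier vectors is summable in j.\<close>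
  define \<eta> where "\<eta> j = (1/2) ^ j / (16 * real (Suc (K j)))" for j
  have \<eta>: "0 < \<eta> j" "\<eta> j \<le> (1/2) ^ j / 16" "2 * real (K j) * \<eta> j \<le> 1/8" for j
  proof -
    show "0 < \<eta> j" by (simp add: \<eta>_def)
    show "\<eta> j \<le> (1/2) ^ j / 16"
      unfolding \<eta>_def by (intro divide_left_mono) auto
    have "2 * real (K j) * \<eta> j \<le> 2 * real (Suc (K j)) * \<eta> j"
      using \<open>0 < \<eta> j\<close> by simp
    also have "\<dots> = (1/2) ^ j / 8"
      unfolding \<eta>_def by (simp del: of_nat_Suc)
    also have "\<dots> \<le> 1/8"
      by (simp add: power_le_one)
    finally show "2 * real (K j) * \<eta> j \<le> 1/8" .
  qed
  define good where "good f j e \<longleftrightarrow> e \<in> active \<and> norm e = 1 \<and> norm (L e - e) \<le> \<eta> j \<and>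
      (\<forall>i<j. \<forall>k\<le>K j. \<bar>(L ^^ (2 * k)) (f i) \<bullet> e\<bar> \<le> \<eta> j)" for f :: "nat \<Rightarrow> 'a" and j e
  \<comment> \<open>The vectors are chosen one after another, each with regard to all earlier ones.\<close>
  have "\<exists>e. \<forall>j. good e j (e j)"
  proof (rule dependent_wellorder_choice)
    fix f :: "nat \<Rightarrow> 'a" and j
    assume prev: "\<And>i. i < j \<Longrightarrow> good f i (f i)"
    define F where "F = (\<lambda>(i, k). (L ^^ (2 * k)) (f i)) ` ({..<j} \<times> {..K j})"
    have "F \<subseteq> active"
      using prev by (auto simp: F_def good_def intro!: pow_active)
    then obtain e where "e \<in> active" "norm e = 1" "norm (L e - e) \<le> \<eta> j" "\<forall>f\<in>F. \<bar>f \<bullet> e\<bar> \<le> \<eta> j"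
      using almost_fixed_almost_orthogonal_vector[OF nogap \<eta>(1), of F j] by (auto simp: F_def)
    then show "\<exists>e. good f j e"
      unfolding good_def F_def by fastforce
  qed (simp add: good_def)
  then obtain e where e_good: "\<And>j. good e j (e j)" by blast
  have e: "e j \<in> active" "norm (e j) = 1" "norm (L (e j) - e j) \<le> \<eta> j" for j
    using e_good[of j] by (auto simp: good_def)
  have cross: "\<bar>e i \<bullet> (L ^^ (2 * k)) (e j)\<bar> \<le> (1/2) ^ j / 16" if "i \<noteq> j" "k \<le> K j" for i j k
  proof (cases "i < j")
    case True
    then have "\<bar>(L ^^ (2 * k)) (e i) \<bullet> e j\<bar> \<le> \<eta> j"
      using e_good[of j] that by (auto simp: good_def)
    with \<eta>(2)[of j] show ?thesis by (simp add: pow_self_adjoint)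
  next
    case False
    then have "j < i" using that by simp
    then have "\<bar>(L ^^ (2 * k)) (e j) \<bullet> e i\<bar> \<le> \<eta> i"
      using e_good[of i] that K_mono[of j i] by (auto simp: good_def)
    also have "\<dots> \<le> (1/2) ^ i / 16" by (rule \<eta>(2))
    also have "\<dots> \<le> (1/2) ^ j / 16"
      using \<open>j < i\<close> by (intro divide_right_mono power_decreasing) auto
    finally show ?thesis by (simp add: inner_commute)
  qed
  have diag: "7/8 \<le> e j \<bullet> (L ^^ (2 * k)) (e j)" if "k \<le> K j" for j k
  proof -
    have "norm ((L ^^ (2 * k)) (e j) - e j) \<le> real (2 * k) * norm (L (e j) - e j)"
      by (rule norm_pow_diff_le)
    also have "\<dots> \<le> real (2 * K j) * \<eta> j"
      using that e(3) by (intro mult_mono) auto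
    finally have "norm ((L ^^ (2 * k)) (e j) - e j) \<le> 1/8"
      using \<eta>(3)[of j] by simp
    moreover have "\<bar>e j \<bullet> ((L ^^ (2 * k)) (e j) - e j)\<bar> \<le> norm ((L ^^ (2 * k)) (e j) - e j)"
      using Cauchy_Schwarz_ineq2[of "e j"] e(2) by simp
    moreover have "e j \<bullet> e j = 1"
      using e(2) by (simp add: norm_eq_1)
    ultimately show ?thesis by (simp add: inner_diff_right)
  qed
  define s where "s n = (\<Sum>i<n. c i *\<^sub>R e i)" for n
  have "summable c"
    unfolding c_def by (intro summable_mult summable_geometric) simp
  moreover have "norm (s (Suc n) - s n) \<le> c n" for n
    using e(2) c[of n] by (simp add: s_def)
  ultimately obtain x where x: "s \<longlonglongrightarrow> x"
    using convergent_of_summable_increments[of s c] by metis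
  have "s n \<in> active" for n
    unfolding s_def using e(1) subspace_active by (intro subspace_sum) (auto intro: subspace_scale)
  then have "x \<in> active"
    using closed_sequentially[OF closed_active _ x] by blast
  have test: "c j / 2 \<le> norm ((L ^^ k) x)" if k: "k \<le> K j" for j k
  proof -
    have "c j / 2 \<le> s n \<bullet> (L ^^ (2 * k)) (e j)" if n: "Suc j \<le> n" for n
    proof -
      \<comment> \<open>The diagonal term is at least 7/8 * c j, and all others together are at most c j / 8, since
        the weight c i and the tolerance combine to c j / 16 * (1/2) ^ i for either order of i and j.\<close>
      let ?t = "\<lambda>i. c i * (e i \<bullet> (L ^^ (2 * k)) (e j))"
      have geo: "(\<Sum>i\<in>{..<n} - {j}. (1/2::real) ^ i) \<le> 2"
      proof -
        have "(\<Sum>i\<in>{..<n} - {j}. (1/2::real) ^ i) \<le> (\<Sum>i. (1/2) ^ i)"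
          by (intro sum_le_suminf summable_geometric) auto
        then show ?thesis by (simp add: suminf_geometric)
      qed
      have "\<bar>\<Sum>i\<in>{..<n} - {j}. ?t i\<bar> \<le> (\<Sum>i\<in>{..<n} - {j}. c j / 16 * (1/2) ^ i)"
      proof (rule order_trans[OF sum_abs sum_mono])
        fix i
        assume "i \<in> {..<n} - {j}"
        then have "\<bar>?t i\<bar> \<le> c i * ((1/2) ^ j / 16)"
          using cross[of i j k] k c[of i] by (simp add: abs_mult mult_left_mono)
        also have "\<dots> = c j / 16 * (1/2) ^ i"
          by (simp add: c_def)
        finally show "\<bar>?t i\<bar> \<le> c j / 16 * (1/2) ^ i" .
      qed
      also have "\<dots> \<le> c j / 16 * 2"
        unfolding sum_distrib_left[symmetric] using geo c[of j] by (intro mult_left_mono) auto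
      finally have off: "\<bar>\<Sum>i\<in>{..<n} - {j}. ?t i\<bar> \<le> c j / 8" by simp
      have "s n \<bullet> (L ^^ (2 * k)) (e j) = (\<Sum>i<n. ?t i)"
        by (simp add: s_def inner_sum_left)
      also have "\<dots> = ?t j + (\<Sum>i\<in>{..<n} - {j}. ?t i)"
        using n by (intro sum.remove) auto
      finally have "s n \<bullet> (L ^^ (2 * k)) (e j) = ?t j + (\<Sum>i\<in>{..<n} - {j}. ?t i)" .
      moreover have "c j * (7/8) \<le> ?t j"
        using diag[OF k] c[of j] by (intro mult_left_mono) auto
      ultimately show ?thesis
        using off c[of j] by linarith
    qed
    moreover have "(\<lambda>n. s n \<bullet> (L ^^ (2 * k)) (e j)) \<longlonglongrightarrow> x \<bullet> (L ^^ (2 * k)) (e j)"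
      by (intro tendsto_intros x)
    ultimately have "c j / 2 \<le> x \<bullet> (L ^^ (2 * k)) (e j)"
      by (intro LIMSEQ_le_const) blast+
    also have "\<dots> = (L ^^ k) x \<bullet> (L ^^ k) (e j)"
      by (simp add: mult_2 pow_pow[symmetric] pow_self_adjoint)
    also have "\<dots> \<le> norm ((L ^^ k) x) * norm ((L ^^ k) (e j))"
      by (rule norm_cauchy_schwarz)
    also have "\<dots> \<le> norm ((L ^^ k) x) * 1"
      using norm_pow_le[of k "e j"] e(2)[of j] by (intro mult_left_mono) auto
    finally show ?thesis by simp
  qed
  have "a k \<le> norm ((L ^^ k) x)" for k
  proof -
    \<comment> \<open>The first hump that is still standing at time k: its predecessor has fallen, so a k has
      already dropped to c j / 2; for j = 0 this holds by the choice of the first weight.\<close>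
    define j where "j = (LEAST j. k < K j)"
    have kj: "k < K j"
      unfolding j_def using K_gt by (rule LeastI)
    have "a k \<le> c j / 2"
    proof (cases j)
      case 0
      then show ?thesis
        using B(2)[of k] by (simp add: c_def)
    next
      case (Suc i)
      then have "\<not> k < K i"
        unfolding j_def by (intro not_less_Least) simp
      then show ?thesis
        using N[of i k] K_N[of i] Suc by simp
    qed
    with test[of k j] kj show ?thesis by simp
  qed
  with \<open>x \<in> active\<close> that show thesis by blast
qed

section \<open>Uniform contraction\<close>

text \<open>
The Neumann series \<open>z = (\<Sum>k. (L ^^ k) y)\<close> inverts \<open>1 - L\<close> on \<open>active\<close>.
\<close>

lemma active_in_range_if_contracts:
  assumes "contracts \<rho>" "0 \<le> \<rho>" "\<rho> < 1" "y \<in> active"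
  obtains z where "y = z - L z"
proof -
  define s where "s n = (\<Sum>k<n. (L ^^ k) y)" for n
  have "norm (s (Suc n) - s n) \<le> \<rho> ^ n * norm y" for n
    using contracts_pow[OF assms(1,2,4)] by (simp add: s_def)
  moreover have "summable (\<lambda>n. \<rho> ^ n * norm y)"
    using assms(2,3) by (intro summable_mult2 summable_geometric) simp
  ultimately obtain z where z: "s \<longlonglongrightarrow> z"
    using convergent_of_summable_increments[of s "\<lambda>n. \<rho> ^ n * norm y"] by metis
  have Ls: "s n - L (s n) = y - (L ^^ n) y" for n
  proof -
    have "s n - L (s n) = (\<Sum>k<n. (L ^^ k) y - (L ^^ Suc k) y)"
      by (simp add: s_def linear_sum[OF linear] sum_subtractf)
    also have "\<dots> = y - (L ^^ n) y"
      by (subst sum_lessThan_telescope') simp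
    finally show ?thesis .
  qed
  have near: "norm ((s n - L (s n)) - (z - L z)) \<le> 2 * norm (s n - z)" for n
  proof -
    have "norm ((s n - L (s n)) - (z - L z)) = norm ((s n - z) - L (s n - z))"
      by (simp add: linear_diff[OF linear] algebra_simps)
    also have "\<dots> \<le> norm (s n - z) + norm (L (s n - z))"
      by (rule norm_triangle_ineq4)
    finally show ?thesis
      using norm_L_le[of "s n - z"] by simp
  qed
  have "(\<lambda>n. 2 * norm (s n - z)) \<longlonglongrightarrow> 0"
    by (intro tendsto_mult_right_zero tendsto_norm_zero LIM_zero z)
  then have "(\<lambda>n. (s n - L (s n)) - (z - L z)) \<longlonglongrightarrow> 0"
    by (rule Lim_null_comparison[rotated]) (intro always_eventually allI near)
  then have "(\<lambda>n. y - (L ^^ n) y) \<longlonglongrightarrow> z - L z"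
    by (simp add: Ls LIM_zero_iff)
  moreover have "(\<lambda>n. y - (L ^^ n) y) \<longlonglongrightarrow> y - 0"
    by (intro tendsto_diff tendsto_const pow_active_tendsto_0 assms(4))
  ultimately have "y = z - L z"
    using LIMSEQ_unique by fastforce
  with that show thesis by blast
qed

text \<open>
The hypothesis says that \<open>active\<close> lies in the range of the square root of \<open>1 - L\<close>. For such a \<open>y\<close>,
inserting \<open>z = (L ^^ (2 * k)) y\<close> bounds \<open>norm ((L ^^ k) y) ^ 4\<close> by a multiple of \<open>1 / sqrt (4 * k + 1)\<close>: a rate
that is the same for all starting points up to a constant. This is incompatible with an orbit that
decays more slowly than the fourth root of that rate.
\<close>

lemma contracts_if_dominated:
  assumes dom: "\<And>y. y \<in> active \<Longrightarrow> \<exists>C. \<forall>z. (y \<bullet> z)\<^sup>2 \<le> C * ((z - L z) \<bullet> z)"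
  shows "\<exists>\<rho><1. contracts \<rho>"
proof (rule ccontr)
  assume "\<not> (\<exists>\<rho><1. contracts \<rho>)"
  then have nogap: "\<And>\<rho>. \<rho> < 1 \<Longrightarrow> \<not> contracts \<rho>" by blast
  \<comment> \<open>The exponent makes a k ^ 8 the decay rate that holds for norm ((L ^^ k) y) ^ 4.\<close>
  define a where "a k = (4 * real k + 1) powr (- 1 / 16)" for k :: nat
  have lim: "filterlim (\<lambda>k. 4 * real k + 1) at_top sequentially"
    by (rule filterlim_at_top_mono[OF filterlim_real_sequentially]) simp
  have a_lim: "a \<longlonglongrightarrow> 0"
    unfolding a_def by (rule tendsto_neg_powr[OF _ lim]) simp
  have a_pos: "0 < a k" for k
    unfolding a_def by (auto simp: add_pos_nonneg)
  have a8: "a k ^ 8 = 1 / sqrt (4 * real k + 1)" for k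
  proof -
    have "a k ^ 8 = (4 * real k + 1) powr (- (1 / 2))"
      using a_pos[of k] by (simp add: a_def powr_power)
    then show ?thesis
      by (simp add: powr_minus_divide powr_half_sqrt)
  qed
  obtain y where y: "y \<in> active" "\<And>k. a k \<le> norm ((L ^^ k) y)"
    using arbitrarily_slow_orbit[OF nogap a_lim] by blast
  obtain C where C: "\<And>z. (y \<bullet> z)\<^sup>2 \<le> C * ((z - L z) \<bullet> z)"
    using dom[OF y(1)] by blast
  define D where "D = \<bar>C\<bar> * (norm y)\<^sup>2"
  have "1 \<le> D * a k ^ 4" for k
  proof -
    define w where "w = (L ^^ (2 * k)) y"
    have "(w - L w) \<bullet> w \<le> norm (w - L w) * norm w"
      by (rule norm_cauchy_schwarz)
    also have "\<dots> \<le> norm y / sqrt (4 * real k + 1) * norm y"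
    proof (intro mult_mono)
      show "norm (w - L w) \<le> norm y / sqrt (4 * real k + 1)"
        using norm_pow_increment[of "2 * k" y] by (simp add: w_def pow_diff pow_L add.commute)
      show "norm w \<le> norm y"
        unfolding w_def by (rule norm_pow_le)
    qed auto
    finally have w: "(w - L w) \<bullet> w \<le> (norm y)\<^sup>2 * a k ^ 8"
      by (simp add: a8 power2_eq_square)
    have w0: "0 \<le> (w - L w) \<bullet> w"
      using inner_pow_decreasing[of 0 w] by (simp add: inner_diff)
    have "a k ^ 4 \<le> norm ((L ^^ k) y) ^ 4"
      using y(2) a_pos[of k] by (intro power_mono) auto
    also have "\<dots> = (y \<bullet> w)\<^sup>2"
      by (simp add: w_def inner_commute[of y] inner_pow_double flip: power_mult)
    also have "\<dots> \<le> C * ((w - L w) \<bullet> w)"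
      by (rule C)
    also have "\<dots> \<le> \<bar>C\<bar> * ((w - L w) \<bullet> w)"
      using w0 by (intro mult_right_mono) auto
    also have "\<dots> \<le> \<bar>C\<bar> * ((norm y)\<^sup>2 * a k ^ 8)"
      using w by (intro mult_left_mono) auto
    finally have "a k ^ 4 \<le> (D * a k ^ 4) * a k ^ 4"
      by (simp add: D_def mult.assoc flip: power_add)
    then show ?thesis
      using a_pos[of k] by simp
  qed
  moreover have "(\<lambda>k. D * a k ^ 4) \<longlonglongrightarrow> D * 0 ^ 4"
    by (intro tendsto_intros a_lim)
  ultimately have "1 \<le> D * 0 ^ 4"
    by (intro LIMSEQ_le_const) blast+
  then show False by simp
qed

section \<open>A dense set of rapidly decaying orbits\<close>

text \<open>
\<open>1 - L ^^ m\<close> is a sum of \<open>m\<close> terms \<open>L ^^ i * (1 - L)\<close>, each of which gains a factor \<open>k powr (- 1 / 2)\<close>.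
\<close>

lemma norm_pow_diff_pow:
  "norm ((L ^^ k) (z - (L ^^ m) z)) * sqrt (real k) \<le> real m * norm z"
proof -
  have inc: "norm ((L ^^ k) ((L ^^ i) z - (L ^^ Suc i) z)) * sqrt (real k) \<le> norm z" for i
  proof -
    have "(L ^^ k) ((L ^^ i) z - (L ^^ Suc i) z) = (L ^^ i) ((L ^^ k) (z - L z))"
      by (simp add: pow_diff pow_pow pow_L add.commute)
    then have "norm ((L ^^ k) ((L ^^ i) z - (L ^^ Suc i) z)) \<le> norm ((L ^^ k) (z - L z))"
      by (simp add: norm_pow_le)
    also have "\<dots> \<le> norm z / sqrt (2 * k + 1)"
      by (rule norm_pow_increment)
    finally have "norm ((L ^^ k) ((L ^^ i) z - (L ^^ Suc i) z)) * sqrt (real k) \<le>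
        norm z / sqrt (2 * k + 1) * sqrt (2 * k + 1)"
      by (rule mult_mono) auto
    also have "\<dots> = norm z"
      by (simp add: add_nonneg_eq_0_iff)
    finally show ?thesis .
  qed
  have "z - (L ^^ m) z = (\<Sum>i<m. (L ^^ i) z - (L ^^ Suc i) z)"
    by (subst sum_lessThan_telescope') simp
  then have "norm ((L ^^ k) (z - (L ^^ m) z)) \<le> (\<Sum>i<m. norm ((L ^^ k) ((L ^^ i) z - (L ^^ Suc i) z)))"
    by (simp only: linear_sum[OF linear_pow] norm_sum)
  then have "norm ((L ^^ k) (z - (L ^^ m) z)) * sqrt (real k) \<le>
      (\<Sum>i<m. norm ((L ^^ k) ((L ^^ i) z - (L ^^ Suc i) z)) * sqrt (real k))"
    unfolding sum_distrib_right[symmetric] by (rule mult_right_mono) simp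
  also have "\<dots> \<le> (\<Sum>i<m. norm z)"
    by (intro sum_mono inc)
  finally show ?thesis by simp
qed

text \<open>
The vector \<open>x\<close> is the infinite product of the operators \<open>1 - L ^^ m n\<close> applied to \<open>y\<close>. Exponents \<open>m n\<close>
that grow fast enough keep the product convergent and close to \<open>y\<close>, because orbits in \<open>active\<close> tend
to 0. The first \<open>n\<close> factors yield the decay of order \<open>n / 2\<close>, and the remaining ones are contractions
that commute with \<open>L\<close> and thus cannot spoil it.
\<close>

theorem rapid_orbit_dense:
  assumes y: "y \<in> active" and \<epsilon>: "0 < \<epsilon>"
  obtains x where "x \<in> active" "norm (x - y) \<le> \<epsilon>"
    "\<And>n. \<exists>D. \<forall>k. norm ((L ^^ (n * k)) x) * sqrt (real k) ^ n \<le> D"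
proof -
  have "\<exists>m. norm ((L ^^ m) z) \<le> \<epsilon> * (1/2) ^ Suc n" if "z \<in> active" for z n
  proof -
    have "eventually (\<lambda>m. norm ((L ^^ m) z) < \<epsilon> * (1/2) ^ Suc n) sequentially"
      using tendsto_norm_zero[OF pow_active_tendsto_0[OF that]] \<epsilon>
      by (intro order_tendstoD(2)) auto
    then show ?thesis
      unfolding eventually_sequentially using less_imp_le by blast
  qed
  then obtain \<mu> where \<mu>: "\<And>z n. z \<in> active \<Longrightarrow> norm ((L ^^ \<mu> z n) z) \<le> \<epsilon> * (1/2) ^ Suc n"
    by metis
  define s where "s = rec_nat y (\<lambda>n z. z - (L ^^ \<mu> z n) z)"
  have s_0: "s 0 = y" and s_Suc: "s (Suc n) = s n - (L ^^ \<mu> (s n) n) (s n)" for n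
    by (simp_all add: s_def)
  have s_active: "s n \<in> active" for n
    by (induction n) (auto simp: s_0 s_Suc y subspace_diff[OF subspace_active] pow_active)
  have "(\<lambda>n. \<epsilon> * (1/2) ^ Suc n) sums \<epsilon>"
    using sums_mult[OF power_half_series, of \<epsilon>] by simp
  moreover have "norm (s (Suc n) - s n) \<le> \<epsilon> * (1/2) ^ Suc n" for n
    using \<mu>[OF s_active, of n n] by (simp add: s_Suc)
  ultimately obtain x where x: "s \<longlonglongrightarrow> x" "norm (x - y) \<le> \<epsilon>"
    using convergent_of_summable_increments[of s "\<lambda>n. \<epsilon> * (1/2) ^ Suc n"]
    unfolding s_0 sums_iff by metis
  have later: "norm ((L ^^ k) (s (n + j))) \<le> norm ((L ^^ k) (s n))" for k n j
  proof (induction j)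
    case (Suc j)
    have "(L ^^ k) (s (n + Suc j)) =
        (L ^^ k) (s (n + j)) - (L ^^ \<mu> (s (n + j)) (n + j)) ((L ^^ k) (s (n + j)))"
      by (simp add: s_Suc pow_diff pow_pow add.commute)
    then show ?case
      using norm_diff_pow_le Suc order_trans by metis
  qed simp
  have limit: "norm ((L ^^ k) x) \<le> norm ((L ^^ k) (s n))" for k n
  proof -
    have "norm ((L ^^ k) (s m) - (L ^^ k) x) \<le> norm (s m - x)" for m
      using norm_pow_le[of k "s m - x"] by (simp add: pow_diff)
    then have "(\<lambda>m. (L ^^ k) (s m) - (L ^^ k) x) \<longlonglongrightarrow> 0"
      by (intro Lim_null_comparison[OF _ tendsto_norm_zero[OF LIM_zero[OF x(1)]]]) auto
    then have "(\<lambda>m. norm ((L ^^ k) (s m))) \<longlonglongrightarrow> norm ((L ^^ k) x)"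
      by (intro tendsto_norm) (simp add: LIM_zero_iff)
    moreover have "norm ((L ^^ k) (s m)) \<le> norm ((L ^^ k) (s n))" if "n \<le> m" for m
      using later[of k n "m - n"] that by simp
    ultimately show ?thesis
      by (intro LIMSEQ_le_const2) blast+
  qed
  have "norm ((L ^^ (n * k)) (s n)) * sqrt (real k) ^ n \<le> (\<Prod>i<n. real (\<mu> (s i) i)) * norm y" for n k
  proof (induction n)
    case (Suc n)
    define w where "w = (L ^^ (n * k)) (s n)"
    have "(L ^^ (Suc n * k)) (s (Suc n)) = (L ^^ k) (w - (L ^^ \<mu> (s n) n) w)"
      by (simp add: w_def s_Suc pow_diff pow_pow add.commute add.left_commute)
    then have "norm ((L ^^ (Suc n * k)) (s (Suc n))) * sqrt (real k) \<le> real (\<mu> (s n) n) * norm w"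
      using norm_pow_diff_pow by metis
    then have "norm ((L ^^ (Suc n * k)) (s (Suc n))) * sqrt (real k) * sqrt (real k) ^ n \<le>
        real (\<mu> (s n) n) * norm w * sqrt (real k) ^ n"
      by (rule mult_right_mono) simp
    also have "\<dots> \<le> real (\<mu> (s n) n) * ((\<Prod>i<n. real (\<mu> (s i) i)) * norm y)"
      unfolding mult.assoc using Suc by (intro mult_left_mono) (auto simp: w_def)
    finally show ?case by (simp add: mult_ac)
  qed (simp add: s_0)
  then have "norm ((L ^^ (n * k)) x) * sqrt (real k) ^ n \<le> (\<Prod>i<n. real (\<mu> (s i) i)) * norm y" for n k
    using mult_right_mono[OF limit[of "n * k" n], of "sqrt (real k) ^ n"] order_trans by fastforce
  moreover have "x \<in> active"
    using closed_sequentially[OF closed_active _ x(1)] s_active by blast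
  ultimately show thesis
    using x(2) that by blast
qed

text \<open>
The bound along multiples of \<open>n\<close> extends to all \<open>k\<close>, since orbit norms decrease and \<open>n * (k div n)\<close> is at
least \<open>k / 2\<close> once \<open>n \<le> k\<close>.
\<close>

lemma super_polynomial_decay:
  assumes D: "\<And>n. \<exists>D. \<forall>k. norm ((L ^^ (n * k)) x) * sqrt (real k) ^ n \<le> D"
  shows "(\<lambda>k. norm ((L ^^ k) x) / real k powr (- \<alpha>)) \<longlonglongrightarrow> 0"
proof -
  \<comment> \<open>Decay of order n / 2 beats the required order \<open>\<alpha>\<close> by one, which leaves a null factor 1 / k.\<close>
  obtain m :: nat where "2 * \<alpha> + 2 \<le> real m"
    using real_arch_simple by blast
  then obtain n :: nat where n: "2 * \<alpha> + 2 \<le> real n" "0 < n"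
    using that[of "Suc m"] by simp
  obtain D where D: "\<And>k. norm ((L ^^ (n * k)) x) * sqrt (real k) ^ n \<le> D"
    using D by blast
  have bound: "norm ((L ^^ k) x) * real k powr \<alpha> \<le> D * (2 * real n) powr (real n / 2) * real k powr (-1)"
    if k: "n \<le> k" for k
  proof -
    define j where "j = k div n"
    have j: "0 < j" "n * j \<le> k" "real k \<le> 2 * real n * real j"
    proof -
      show "0 < j" "n * j \<le> k"
        using k n by (auto simp: j_def div_greater_zero_iff)
      have "k < n * j + n"
        unfolding j_def using n dividend_less_times_div[of n k] by (simp add: add.commute)
      also have "n * j + n \<le> 2 * n * j"
        using \<open>0 < j\<close> by simp
      finally show "real k \<le> 2 * real n * real j"
        by (metis less_imp_le of_nat_le_iff of_nat_mult of_nat_numeral)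
    qed
    have "0 < k" using k n by simp
    have "norm ((L ^^ k) x) * real k powr (\<alpha> + 1) \<le> norm ((L ^^ (n * j)) x) * (2 * real n * real j) powr (real n / 2)"
    proof (rule mult_mono)
      show "norm ((L ^^ k) x) \<le> norm ((L ^^ (n * j)) x)"
        by (rule norm_pow_antimono[OF j(2)])
      have "real k powr (\<alpha> + 1) \<le> real k powr (real n / 2)"
        using \<open>0 < k\<close> n by (intro powr_mono) auto
      also have "\<dots> \<le> (2 * real n * real j) powr (real n / 2)"
        using j by (intro powr_mono2) auto
      finally show "real k powr (\<alpha> + 1) \<le> (2 * real n * real j) powr (real n / 2)" .
    qed auto
    also have "\<dots> = (norm ((L ^^ (n * j)) x) * sqrt (real j) ^ n) * (2 * real n) powr (real n / 2)"
    proof -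
      have "real j powr (real n / 2) = (real j powr (1/2)) powr real n"
        by (simp add: powr_powr)
      also have "\<dots> = sqrt (real j) ^ n"
        using j by (simp add: powr_half_sqrt powr_realpow)
      finally show ?thesis
        by (simp add: powr_mult)
    qed
    also have "\<dots> \<le> D * (2 * real n) powr (real n / 2)"
      by (intro mult_right_mono D) simp
    finally have "norm ((L ^^ k) x) * (real k powr \<alpha> * real k) \<le> D * (2 * real n) powr (real n / 2)"
      using \<open>0 < k\<close> by (simp add: powr_add)
    then show ?thesis
      using \<open>0 < k\<close> by (simp add: powr_minus divide_simps mult.assoc)
  qed
  have "(\<lambda>k. D * (2 * real n) powr (real n / 2) * real k powr (-1)) \<longlonglongrightarrow> D * (2 * real n) powr (real n / 2) * 0"
    by (intro tendsto_mult tendsto_const tendsto_neg_powr filterlim_real_sequentially) simp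
  then have "(\<lambda>k. D * (2 * real n) powr (real n / 2) * real k powr (-1)) \<longlonglongrightarrow> 0" by simp
  then have "(\<lambda>k. norm ((L ^^ k) x) * real k powr \<alpha>) \<longlonglongrightarrow> 0"
  proof (rule Lim_null_comparison[rotated])
    show "\<forall>\<^sub>F k in sequentially. norm (norm ((L ^^ k) x) * real k powr \<alpha>) \<le>
        D * (2 * real n) powr (real n / 2) * real k powr (-1)"
      using bound by (auto simp: eventually_sequentially abs_mult intro!: exI[of _ n])
  qed
  then show ?thesis
    by (simp add: powr_minus divide_inverse)
qed

end

section \<open>Averages of orthogonal projections\<close>

lemma linear_metric_proj:
  fixes M :: "'a::{real_inner, complete_space} set"
  assumes M: "subspace M" "closed M"
  shows "linear (metric_proj M)"
proof (rule linearI)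
  fix x y :: 'a and c :: real
  show "metric_proj M (x + y) = metric_proj M x + metric_proj M y"
  proof (rule metric_proj_subspace_eqI[OF M(1)])
    show "metric_proj M x + metric_proj M y \<in> M"
      using metric_proj_in[OF M] by (intro subspace_add[OF M(1)])
    fix u assume "u \<in> M"
    then show "(x + y - (metric_proj M x + metric_proj M y)) \<bullet> u = 0"
      using metric_proj_orthogonal[OF M, of u x] metric_proj_orthogonal[OF M, of u y]
      by (simp add: inner_diff_left inner_add_left)
  qed
  show "metric_proj M (c *\<^sub>R x) = c *\<^sub>R metric_proj M x"
  proof (rule metric_proj_subspace_eqI[OF M(1)])
    show "c *\<^sub>R metric_proj M x \<in> M"
      using metric_proj_in[OF M] by (intro subspace_scale[OF M(1)])
    fix u assume "u \<in> M"
    then show "(c *\<^sub>R x - c *\<^sub>R metric_proj M x) \<bullet> u = 0"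
      using metric_proj_orthogonal[OF M, of u x]
      by (simp flip: scaleR_diff_right)
  qed
qed

lemma metric_proj_self_adjoint:
  fixes M :: "'a::{real_inner, complete_space} set"
  assumes M: "subspace M" "closed M"
  shows "metric_proj M x \<bullet> y = x \<bullet> metric_proj M y"
proof -
  have "metric_proj M x \<bullet> y = metric_proj M x \<bullet> metric_proj M y"
    using metric_proj_orthogonal[OF M metric_proj_in[OF M], of y x]
    by (simp add: inner_diff_left inner_commute[of "metric_proj M x"])
  also have "\<dots> = x \<bullet> metric_proj M y"
    using metric_proj_orthogonal[OF M metric_proj_in[OF M], of x y]
    by (simp add: inner_diff_left)
  finally show ?thesis .
qed

lemma metric_proj_ident:
  fixes M :: "'a::{real_inner, complete_space} set"
  shows "subspace M \<Longrightarrow> x \<in> M \<Longrightarrow> metric_proj M x = x"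
  by (rule metric_proj_subspace_eqI) auto

locale closed_subspace_family =
  fixes M :: "nat \<Rightarrow> 'a::{real_inner, complete_space} set" and r :: nat
  assumes r: "2 \<le> r"
    and subspace: "\<And>i. i \<in> {1..r} \<Longrightarrow> subspace (M i)"
    and closed: "\<And>i. i \<in> {1..r} \<Longrightarrow> closed (M i)"
begin

abbreviation P :: "nat \<Rightarrow> 'a \<Rightarrow> 'a" where "P i \<equiv> metric_proj (M i)"
abbreviation L :: "'a \<Rightarrow> 'a" where "L \<equiv> simultaneous_proj r M"
definition common :: "'a set" where "common = (\<Inter>i\<in>{1..r}. M i)"
abbreviation Q :: "'a \<Rightarrow> 'a" where "Q \<equiv> metric_proj common"

lemma mem_common: "x \<in> common \<longleftrightarrow> (\<forall>i\<in>{1..r}. x \<in> M i)"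
  by (simp add: common_def)

lemma P_in: "i \<in> {1..r} \<Longrightarrow> P i x \<in> M i"
  by (intro metric_proj_in subspace closed)

lemma P_orthogonal: "i \<in> {1..r} \<Longrightarrow> u \<in> M i \<Longrightarrow> (x - P i x) \<bullet> u = 0"
  by (intro metric_proj_orthogonal subspace closed)

lemma inner_P_P: "i \<in> {1..r} \<Longrightarrow> P i x \<bullet> P i x = P i x \<bullet> x"
  using P_orthogonal[OF _ P_in, of i x x] by (simp add: inner_diff inner_commute)

lemma inner_L: "L x \<bullet> y = (1 / real r) * (\<Sum>i=1..r. P i x \<bullet> y)"
  by (simp add: simultaneous_proj_def inner_sum_left)

lemma sum_norm_P: "(\<Sum>i=1..r. (norm (P i x))\<^sup>2) = real r * (L x \<bullet> x)"
proof -
  have "(\<Sum>i=1..r. (norm (P i x))\<^sup>2) = (\<Sum>i=1..r. P i x \<bullet> x)"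
    by (intro sum.cong refl) (simp only: power2_norm_eq_inner inner_P_P)
  then show ?thesis
    using r by (simp add: inner_L)
qed

lemma norm_sum_sq_le: "(norm (\<Sum>i=1..r. x i))\<^sup>2 \<le> real r * (\<Sum>i=1..r. (norm (x i))\<^sup>2)"
  for x :: "nat \<Rightarrow> 'a"
proof -
  have "(norm (\<Sum>i=1..r. x i))\<^sup>2 \<le> (\<Sum>i=1..r. norm (x i))\<^sup>2"
    by (intro power_mono norm_sum) simp
  also have "\<dots> \<le> (\<Sum>i=1..r. (norm (x i))\<^sup>2) * card {1..r}"
    by (rule sum_squared_le_sum_of_squares)
  finally show ?thesis by (simp add: mult.commute)
qed

sublocale positive_contraction L
proof (rule positive_contraction.intro)
  show "linear L"
    unfolding simultaneous_proj_def
    by (intro linear_compose_scale_right linear_compose_sum ballI linear_metric_proj subspace closed)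
  show "L x \<bullet> y = x \<bullet> L y" for x y
  proof -
    have "(\<Sum>i=1..r. P i x \<bullet> y) = (\<Sum>i=1..r. P i y \<bullet> x)"
      by (intro sum.cong refl)
         (simp add: metric_proj_self_adjoint[OF subspace closed] inner_commute[of x])
    then have "L x \<bullet> y = L y \<bullet> x"
      by (simp add: inner_L)
    then show ?thesis by (simp add: inner_commute)
  qed
  show "L x \<bullet> L x \<le> L x \<bullet> x" for x
  proof -
    have "L x \<bullet> L x = (1 / real r)\<^sup>2 * (norm (\<Sum>i=1..r. P i x))\<^sup>2"
      unfolding power2_norm_eq_inner by (simp add: simultaneous_proj_def power2_eq_square)
    also have "\<dots> \<le> (1 / real r)\<^sup>2 * (real r * (\<Sum>i=1..r. (norm (P i x))\<^sup>2))"
      by (intro mult_left_mono norm_sum_sq_le) simp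
    also have "\<dots> = L x \<bullet> x"
      unfolding sum_norm_P using r by (simp add: power2_eq_square)
    finally show ?thesis .
  qed
qed

text \<open>
The form of \<open>1 - L\<close> is the mean squared distance to the subspaces, which links \<open>L\<close> to the orthogonal
complements of the \<open>M i\<close>.
\<close>

lemma inner_defect: "(z - L z) \<bullet> z = (1 / real r) * (\<Sum>i=1..r. (norm (z - P i z))\<^sup>2)"
proof -
  have "(norm (z - P i z))\<^sup>2 = z \<bullet> z - P i z \<bullet> z" if "i \<in> {1..r}" for i
    using inner_P_P[OF that, of z] by (simp add: power2_norm_eq_inner inner_diff inner_commute)
  then have "(\<Sum>i=1..r. (norm (z - P i z))\<^sup>2) = real r * (z \<bullet> z) - (\<Sum>i=1..r. P i z \<bullet> z)"
    by (simp add: sum_subtractf)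
  then show ?thesis
    using r by (simp add: inner_diff_left inner_L field_simps)
qed

text \<open>
A fixed point makes all terms of \<open>inner_defect\<close> vanish.
\<close>

lemma fixed_iff: "L x = x \<longleftrightarrow> x \<in> common"
proof
  assume "L x = x"
  then have "(\<Sum>i=1..r. (norm (x - P i x))\<^sup>2) = 0"
    using inner_defect[of x] r by simp
  then have "x = P i x" if "i \<in> {1..r}" for i
    using that by (simp add: sum_nonneg_eq_0_iff)
  then show "x \<in> common"
    unfolding mem_common using P_in by metis
next
  assume x: "x \<in> common"
  have "(\<Sum>i=1..r. P i x) = (\<Sum>i=1..r. x)"
    using x unfolding mem_common by (intro sum.cong refl metric_proj_ident subspace) auto
  then show "L x = x"
    using r by (simp add: simultaneous_proj_def sum_constant_scaleR)
qed

lemma active_eq: "active = orthogonal_comp common"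
  by (simp only: active_def fixed_iff Collect_mem_eq)

lemma activeD: "y \<in> active \<Longrightarrow> z \<in> common \<Longrightarrow> z \<bullet> y = 0"
  by (simp add: active_iff fixed_iff)

lemma activeI: "(\<And>z. z \<in> common \<Longrightarrow> z \<bullet> y = 0) \<Longrightarrow> y \<in> active"
  by (simp add: active_iff fixed_iff)

lemma subspace_common: "subspace common"
  unfolding common_def by (intro subspace_Inter) (auto simp: subspace)

lemma closed_common: "closed common"
  unfolding common_def by (intro closed_INT) (auto simp: closed)

lemma diff_Q_active: "x - Q x \<in> active"
  using metric_proj_orthogonal[OF subspace_common closed_common]
  by (intro activeI) (simp add: inner_commute)

lemma P_active: "y \<in> active \<Longrightarrow> i \<in> {1..r} \<Longrightarrow> P i y \<in> active"
proof (rule activeI)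
  fix z
  assume y: "y \<in> active" "i \<in> {1..r}" and z: "z \<in> common"
  have "z \<bullet> P i y = P i z \<bullet> y"
    using y(2) by (simp add: metric_proj_self_adjoint subspace closed)
  also have "P i z = z"
    using y(2) z by (intro metric_proj_ident subspace) (auto simp: mem_common)
  finally show "z \<bullet> P i y = 0"
    using activeD[OF y(1) z] by simp
qed

abbreviation complement_sum :: "'a set" where "complement_sum \<equiv> (\<Sum>i=1..r. orthogonal_comp (M i))"

lemma mem_complement_sum: "y \<in> complement_sum \<longleftrightarrow>
    (\<exists>u. y = (\<Sum>i=1..r. u i) \<and> (\<forall>i\<in>{1..r}. u i \<in> orthogonal_comp (M i)))"
  by (subst set_sum_alt) auto

lemma orthogonal_compD: "u \<in> orthogonal_comp W \<Longrightarrow> x \<in> W \<Longrightarrow> u \<bullet> x = 0"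
  by (auto simp: orthogonal_comp_def orthogonal_def inner_commute[of u])

lemma diff_P_orthogonal_comp: "i \<in> {1..r} \<Longrightarrow> z - P i z \<in> orthogonal_comp (M i)"
  using P_orthogonal[of i _ z] by (auto simp: orthogonal_comp_def orthogonal_def inner_commute)

lemma complement_sum_subset_active: "complement_sum \<subseteq> active"
proof
  fix y
  assume "y \<in> complement_sum"
  then obtain u where u: "y = (\<Sum>i=1..r. u i)" "\<And>i. i \<in> {1..r} \<Longrightarrow> u i \<in> orthogonal_comp (M i)"
    unfolding mem_complement_sum by blast
  show "y \<in> active"
  proof (rule activeI)
    fix z
    assume z: "z \<in> common"
    have "u i \<bullet> z = 0" if "i \<in> {1..r}" for i
      using orthogonal_compD[OF u(2)[OF that]] z that unfolding mem_common by blast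
    then show "z \<bullet> y = 0"
      by (simp add: u(1) inner_sum_right inner_commute)
  qed
qed

lemma subspace_complement_sum: "subspace complement_sum"
  unfolding subspace_def
proof (intro conjI ballI allI)
  show "0 \<in> complement_sum"
    unfolding mem_complement_sum by (intro exI[of _ "\<lambda>_. 0"]) (simp add: subspace_0 subspace_orthogonal_comp)
  fix x assume "x \<in> complement_sum"
  then obtain u where u: "x = (\<Sum>i=1..r. u i)" "\<forall>i\<in>{1..r}. u i \<in> orthogonal_comp (M i)"
    unfolding mem_complement_sum by blast
  show "c *\<^sub>R x \<in> complement_sum" for c
    unfolding mem_complement_sum using u
    by (intro exI[of _ "\<lambda>i. c *\<^sub>R u i"])
       (simp add: scaleR_sum_right subspace_scale subspace_orthogonal_comp)
  fix y assume "y \<in> complement_sum"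
  then obtain w where w: "y = (\<Sum>i=1..r. w i)" "\<forall>i\<in>{1..r}. w i \<in> orthogonal_comp (M i)"
    unfolding mem_complement_sum by blast
  show "x + y \<in> complement_sum"
    unfolding mem_complement_sum using u w
    by (intro exI[of _ "\<lambda>i. u i + w i"])
       (simp add: sum.distrib subspace_add subspace_orthogonal_comp)
qed

lemma orthogonal_comp_subset_complement_sum:
  assumes "i \<in> {1..r}" "w \<in> orthogonal_comp (M i)"
  shows "w \<in> complement_sum"
  unfolding mem_complement_sum using assms
  by (intro exI[of _ "\<lambda>j. if j = i then w else 0"])
     (auto simp: subspace_0 subspace_orthogonal_comp)

text \<open>
If the sum is closed, a vector of \<open>active\<close> can be projected onto it. The remainder is orthogonal to
every \<open>orthogonal_comp (M i)\<close>, hence lies in every \<open>M i\<close>; being in \<open>active\<close> as well, it is 0.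
\<close>

lemma active_eq_complement_sum_if_closed:
  assumes "closed complement_sum"
  shows "active = complement_sum"
proof
  show "active \<subseteq> complement_sum"
  proof
    fix y
    assume y: "y \<in> active"
    obtain p where p: "p \<in> complement_sum" "\<And>u. u \<in> complement_sum \<Longrightarrow> (y - p) \<bullet> u = 0"
      using closed_subspace_orthogonal_decomposition[OF subspace_complement_sum assms] by blast
    define w where "w = y - p"
    have "w \<in> M i" if i: "i \<in> {1..r}" for i
    proof -
      have "w \<bullet> (w - P i w) = 0"
        unfolding w_def
        using p(2)[OF orthogonal_comp_subset_complement_sum[OF i diff_P_orthogonal_comp[OF i]]] .
      then have "(norm (w - P i w))\<^sup>2 = 0"
        using inner_P_P[OF i, of w] by (simp add: power2_norm_eq_inner inner_diff inner_commute)
      then show ?thesis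
        using P_in[OF i, of w] by simp
    qed
    then have "w \<in> common" unfolding mem_common by blast
    moreover have "w \<in> active"
      unfolding w_def using y p(1) complement_sum_subset_active by (intro subspace_diff subspace_active) auto
    ultimately have "w \<bullet> w = 0"
      using activeD by blast
    with p(1) show "y \<in> complement_sum" by (simp add: w_def)
  qed
qed (rule complement_sum_subset_active)

text \<open>
If \<open>y\<close> is a sum of vectors \<open>u i\<close> orthogonal to \<open>M i\<close>, then \<open>y \<bullet> z\<close> sees only the components \<open>z - P i z\<close>, whose
squared norms sum up to the form of \<open>1 - L\<close>.
\<close>

lemma complement_sum_dominated:
  assumes "y \<in> complement_sum"
  shows "\<exists>C. \<forall>z. (y \<bullet> z)\<^sup>2 \<le> C * ((z - L z) \<bullet> z)"
proof -
  obtain u where u: "y = (\<Sum>i=1..r. u i)" "\<And>i. i \<in> {1..r} \<Longrightarrow> u i \<in> orthogonal_comp (M i)"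
    using assms unfolding mem_complement_sum by blast
  have "(y \<bullet> z)\<^sup>2 \<le> (real r * (\<Sum>i=1..r. (norm (u i))\<^sup>2)) * ((z - L z) \<bullet> z)" for z
  proof -
    have "y \<bullet> z = (\<Sum>i=1..r. u i \<bullet> (z - P i z))"
      unfolding u(1) inner_sum_left
      by (intro sum.cong refl) (simp add: inner_diff_right orthogonal_compD[OF u(2) P_in])
    also have "\<bar>\<dots>\<bar> \<le> (\<Sum>i=1..r. norm (u i) * norm (z - P i z))"
      by (intro order_trans[OF sum_abs sum_mono] Cauchy_Schwarz_ineq2)
    finally have "\<bar>y \<bullet> z\<bar>\<^sup>2 \<le> (\<Sum>i=1..r. norm (u i) * norm (z - P i z))\<^sup>2"
      by (intro power_mono) auto
    also have "\<dots> \<le> (\<Sum>i=1..r. (norm (u i))\<^sup>2) * (\<Sum>i=1..r. (norm (z - P i z))\<^sup>2)"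
      by (rule Cauchy_Schwarz_ineq_sum)
    also have "\<dots> = (real r * (\<Sum>i=1..r. (norm (u i))\<^sup>2)) * ((z - L z) \<bullet> z)"
      using r by (simp add: inner_defect)
    finally show ?thesis by simp
  qed
  then show ?thesis by blast
qed

theorem closed_complement_sum_iff: "closed complement_sum \<longleftrightarrow> (\<exists>\<rho><1. contracts \<rho>)"
proof
  assume "closed complement_sum"
  then show "\<exists>\<rho><1. contracts \<rho>"
    using contracts_if_dominated complement_sum_dominated active_eq_complement_sum_if_closed by blast
next
  assume "\<exists>\<rho><1. contracts \<rho>"
  then obtain \<rho> where \<rho>: "\<rho> < 1" "contracts \<rho>" by blast
  have "contracts (max \<rho> 0)"
    unfolding contracts_def
  proof
    fix y
    assume "y \<in> active"
    then have "norm (L y) \<le> \<rho> * norm y"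
      using \<rho>(2) by (simp add: contracts_def)
    also have "\<dots> \<le> max \<rho> 0 * norm y"
      by (intro mult_right_mono) auto
    finally show "norm (L y) \<le> max \<rho> 0 * norm y" .
  qed
  have "active \<subseteq> complement_sum"
  proof
    fix y
    assume "y \<in> active"
    then obtain z where z: "y = z - L z"
      using active_in_range_if_contracts[OF \<open>contracts (max \<rho> 0)\<close>] \<rho>(1) by auto
    have "y = (\<Sum>i=1..r. (1 / real r) *\<^sub>R (z - P i z))"
      unfolding z simultaneous_proj_def scaleR_sum_right[symmetric]
      using r by (simp add: sum_subtractf scaleR_diff_right sum_constant_scaleR)
    moreover have "(1 / real r) *\<^sub>R (z - P i z) \<in> orthogonal_comp (M i)" if "i \<in> {1..r}" for i
      by (intro subspace_scale subspace_orthogonal_comp diff_P_orthogonal_comp that)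
    ultimately show "y \<in> complement_sum"
      unfolding mem_complement_sum by (intro exI[of _ "\<lambda>i. (1 / real r) *\<^sub>R (z - P i z)"]) simp
  qed
  then have "complement_sum = active"
    using complement_sum_subset_active by blast
  then show "closed complement_sum"
    using closed_active by simp
qed

section \<open>The Friedrichs number as an operator norm\<close>

definition rate :: real where
  "rate = (real r - 1) / real r * friedrichs_number r M + 1 / real r"

definition admissible :: "(nat \<Rightarrow> 'a) \<Rightarrow> bool" where
  "admissible x \<longleftrightarrow> (\<forall>i\<in>{1..r}. x i \<in> M i \<inter> active) \<and> (\<Sum>i=1..r. (norm (x i))\<^sup>2) \<noteq> 0"

text \<open>
The ratio in the definition of the Friedrichs number, rescaled affinely such that its supremum is
\<open>rate\<close>.
\<close>

definition quotient :: "(nat \<Rightarrow> 'a) \<Rightarrow> real" where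
  "quotient x = (norm (\<Sum>i=1..r. x i))\<^sup>2 / (real r * (\<Sum>i=1..r. (norm (x i))\<^sup>2))"

text \<open>
Adding the diagonal terms to the sum over \<open>i \<noteq> j\<close> completes it to the squared norm of \<open>\<Sum>i. x i\<close>.
\<close>

lemma friedrichs_quotient:
  assumes "(\<Sum>i=1..r. (norm (x i))\<^sup>2) \<noteq> 0"
  shows "1 / (real r - 1) *
      ((\<Sum>i=1..r. \<Sum>j\<in>{1..r} - {i}. x i \<bullet> x j) / (\<Sum>i=1..r. (norm (x i))\<^sup>2)) =
    (real r * quotient x - 1) / (real r - 1)"
proof -
  have "(\<Sum>j\<in>{1..r} - {i}. x i \<bullet> x j) = x i \<bullet> (\<Sum>j=1..r. x j) - (norm (x i))\<^sup>2"
    if "i \<in> {1..r}" for i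
    using that by (simp add: sum_diff1 inner_sum_right power2_norm_eq_inner)
  then have "(\<Sum>i=1..r. \<Sum>j\<in>{1..r} - {i}. x i \<bullet> x j) =
      (\<Sum>i=1..r. x i \<bullet> (\<Sum>j=1..r. x j)) - (\<Sum>i=1..r. (norm (x i))\<^sup>2)"
    by (simp add: sum_subtractf)
  also have "(\<Sum>i=1..r. x i \<bullet> (\<Sum>j=1..r. x j)) = (norm (\<Sum>i=1..r. x i))\<^sup>2"
    by (simp only: power2_norm_eq_inner inner_sum_left)
  finally show ?thesis
    using assms r by (simp add: quotient_def diff_divide_distrib)
qed

lemma friedrichs_number_eq:
  "friedrichs_number r M = Sup ((\<lambda>x. (real r * quotient x - 1) / (real r - 1)) ` Collect admissible)"
  unfolding friedrichs_number_def common_def[symmetric] setcompr_eq_image admissible_def active_eq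
  by (rule arg_cong[where f = Sup], rule image_cong[OF refl]) (rule friedrichs_quotient, simp)

text \<open>
With \<open>s = (\<Sum>i. x i)\<close> one has \<open>s \<bullet> s = (\<Sum>i. x i \<bullet> P i s)\<close>; the Cauchy-Schwarz inequality and
\<open>sum_norm_P\<close> bring in the form of \<open>L\<close> at \<open>s\<close>.
\<close>

lemma quotient_le:
  assumes "contracts p" "admissible x"
  shows "quotient x \<le> p"
proof -
  define s where "s = (\<Sum>i=1..r. x i)"
  define N where "N = (\<Sum>i=1..r. (norm (x i))\<^sup>2)"
  have x: "x i \<in> M i" "x i \<in> active" if "i \<in> {1..r}" for i
    using assms(2) that by (auto simp: admissible_def)
  have "0 \<le> N"
    unfolding N_def by (intro sum_nonneg) simp
  then have N: "0 < N"
    using assms(2) by (simp add: N_def admissible_def)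
  have s: "s \<in> active"
    unfolding s_def by (intro subspace_sum subspace_active x)
  have "(norm s)\<^sup>2 = (\<Sum>i=1..r. x i \<bullet> s)"
    by (simp only: power2_norm_eq_inner s_def inner_sum_left)
  also have "\<dots> = (\<Sum>i=1..r. x i \<bullet> P i s)"
  proof (intro sum.cong refl)
    fix i assume i: "i \<in> {1..r}"
    show "x i \<bullet> s = x i \<bullet> P i s"
      using P_orthogonal[OF i x(1)[OF i], of s]
      by (simp add: inner_commute[of _ "x i"] inner_diff_right)
  qed
  also have "\<dots> \<le> (\<Sum>i=1..r. norm (x i) * norm (P i s))"
    by (intro sum_mono norm_cauchy_schwarz)
  finally have "((norm s)\<^sup>2)\<^sup>2 \<le> (\<Sum>i=1..r. norm (x i) * norm (P i s))\<^sup>2"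
    by (intro power_mono) auto
  also have "\<dots> \<le> N * (\<Sum>i=1..r. (norm (P i s))\<^sup>2)"
    unfolding N_def by (rule Cauchy_Schwarz_ineq_sum)
  also have "(\<Sum>i=1..r. (norm (P i s))\<^sup>2) = real r * (L s \<bullet> s)"
    by (rule sum_norm_P)
  also have "N * (real r * (L s \<bullet> s)) \<le> N * (real r * (p * (norm s)\<^sup>2))"
  proof -
    have "L s \<bullet> s \<le> norm (L s) * norm s"
      by (rule norm_cauchy_schwarz)
    also have "\<dots> \<le> p * norm s * norm s"
      using assms(1) s by (intro mult_right_mono) (auto simp: contracts_def)
    finally show ?thesis
      using N by (intro mult_left_mono) (auto simp: power2_eq_square)
  qed
  finally have le: "(norm s)\<^sup>2 * (norm s)\<^sup>2 \<le> (p * (real r * N)) * (norm s)\<^sup>2"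
    by (simp add: power2_eq_square mult_ac)
  show ?thesis
  proof (cases "s = 0")
    case False
    then have "(norm s)\<^sup>2 \<le> p * (real r * N)"
      by (intro mult_right_le_imp_le[OF le]) simp
    then show ?thesis
      unfolding quotient_def s_def[symmetric] N_def[symmetric]
      using N r by (simp add: pos_divide_le_eq)
  next
    case True
    obtain i where "i \<in> {1..r}" "x i \<noteq> 0"
      using N unfolding N_def by (metis (no_types, lifting) less_irrefl norm_zero power_zero_numeral sum.neutral)
    then have "0 \<le> p * norm (x i)"
      using assms(1) x(2) norm_ge_zero order_trans unfolding contracts_def by blast
    then have "0 \<le> p"
      using \<open>x i \<noteq> 0\<close> by (simp add: zero_le_mult_iff)
    with True show ?thesis
      unfolding quotient_def s_def[symmetric] by simp
  qed
qed

lemma rate_le: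
  assumes "contracts p" "admissible x0"
  shows "rate \<le> p"
proof -
  have "friedrichs_number r M \<le> (real r * p - 1) / (real r - 1)"
    unfolding friedrichs_number_eq
    using assms r by (intro cSup_least) (auto intro!: divide_right_mono simp: quotient_le)
  then have "(real r - 1) / real r * friedrichs_number r M \<le>
      (real r - 1) / real r * ((real r * p - 1) / (real r - 1))"
    using r by (intro mult_left_mono) auto
  also have "\<dots> = p - 1 / real r"
    using r by (simp add: field_simps)
  finally show ?thesis by (simp add: rate_def)
qed

lemma quotient_le_rate:
  assumes "admissible x"
  shows "quotient x \<le> rate"
proof -
  have "contracts 1"
    by (simp add: contracts_def norm_L_le)
  then have "bdd_above ((\<lambda>x. (real r * quotient x - 1) / (real r - 1)) ` Collect admissible)"
    using r
    by (intro bdd_aboveI2[where M = "(real r * 1 - 1) / (real r - 1)"] divide_right_mono diff_right_mono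
        mult_left_mono quotient_le) auto
  then have "(real r * quotient x - 1) / (real r - 1) \<le> friedrichs_number r M"
    unfolding friedrichs_number_eq using assms by (intro cSup_upper) auto
  then have "(real r - 1) / real r * ((real r * quotient x - 1) / (real r - 1)) \<le>
      (real r - 1) / real r * friedrichs_number r M"
    using r by (intro mult_left_mono) auto
  moreover have "(real r - 1) / real r * ((real r * quotient x - 1) / (real r - 1)) =
      quotient x - 1 / real r"
    using r by (simp add: field_simps)
  ultimately show ?thesis by (simp add: rate_def)
qed

text \<open>
For \<open>x i = P i y\<close> the quotient equals \<open>(norm (L y))\<^sup>2 / (L y \<bullet> y)\<close>, and a bound \<open>q\<close> for it yields
\<open>(norm (L y))\<^sup>2 \<le> q * norm (L y) * norm y\<close>.
\<close>

lemma contracts_rate: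
  assumes "0 \<le> rate"
  shows "contracts rate"
  unfolding contracts_def
proof
  fix y
  assume y: "y \<in> active"
  note N = sum_norm_P[of y]
  show "norm (L y) \<le> rate * norm y"
  proof (cases "L y \<bullet> y = 0")
    case True
    then have "L y = 0"
      using firm[of y] by (metis inner_eq_zero_iff inner_ge_zero order_antisym)
    then show ?thesis using assms by simp
  next
    case False
    then have pos: "0 < L y \<bullet> y"
      using inner_L_nonneg[of y] by simp
    have "admissible (\<lambda>i. P i y)"
      using False r y N P_in P_active by (simp add: admissible_def)
    then have "quotient (\<lambda>i. P i y) \<le> rate"
      by (rule quotient_le_rate)
    moreover have "(\<Sum>i=1..r. P i y) = real r *\<^sub>R L y"
      using r by (simp add: simultaneous_proj_def)
    ultimately have "(norm (L y))\<^sup>2 / (L y \<bullet> y) \<le> rate"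
      using r unfolding quotient_def N by (simp add: power_mult_distrib power2_eq_square)
    then have "(norm (L y))\<^sup>2 \<le> rate * (L y \<bullet> y)"
      using pos by (simp add: pos_divide_le_eq)
    also have "\<dots> \<le> rate * (norm (L y) * norm y)"
      using assms by (intro mult_left_mono norm_cauchy_schwarz)
    finally have "norm (L y) * norm (L y) \<le> (rate * norm y) * norm (L y)"
      by (simp add: power2_eq_square mult_ac)
    moreover have "0 < norm (L y)"
      using pos by auto
    ultimately show ?thesis by simp
  qed
qed

text \<open>
If the subspaces are not all equal, one of them contains a nonzero vector orthogonal to the common
part, and the tuple with this single nonzero entry has quotient \<open>1 / r\<close>. Thus the supremum is over a
nonempty set, and \<open>rate\<close> is positive.
\<close>

lemma admissible_exists:
  assumes "i \<in> {1..r}" "j \<in> {1..r}" "M i \<noteq> M j"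
  obtains x where "admissible x" "quotient x = 1 / real r"
proof -
  have "\<exists>i\<in>{1..r}. \<not> M i \<subseteq> common"
  proof (rule ccontr)
    assume "\<not> ?thesis"
    then have "M i = common" "M j = common"
      using assms(1,2) unfolding common_def by blast+
    then show False using assms(3) by simp
  qed
  then obtain k u where k: "k \<in> {1..r}" "u \<in> M k" "u \<notin> common"
    by blast
  define w where "w = u - Q u"
  have Q: "Q u \<in> common"
    by (rule metric_proj_in[OF subspace_common closed_common])
  have w: "w \<noteq> 0" "w \<in> M k" "w \<in> active"
  proof -
    show "w \<noteq> 0" using k Q by (auto simp: w_def)
    show "w \<in> M k"
      unfolding w_def using k(1) k(2) Q by (intro subspace_diff[OF subspace]) (auto simp: mem_common)
    show "w \<in> active"
      unfolding w_def by (rule diff_Q_active)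
  qed
  define x where "x i = (if i = k then w else 0)" for i
  have "(\<Sum>i=1..r. (norm (x i))\<^sup>2) = (\<Sum>i=1..r. if i = k then (norm w)\<^sup>2 else 0)"
    unfolding x_def by (intro sum.cong) auto
  then have N: "(\<Sum>i=1..r. (norm (x i))\<^sup>2) = (norm w)\<^sup>2"
    using k(1) by simp
  have s: "(\<Sum>i=1..r. x i) = w"
    using k(1) by (simp add: x_def)
  have "admissible x"
    unfolding admissible_def N using w
    by (auto simp: x_def subspace_0 subspace subspace_active)
  moreover have "quotient x = 1 / real r"
    unfolding quotient_def N s using w by simp
  ultimately show thesis by (rule that)
qed

end

section \<open>Affine subspaces with a common point\<close>

locale affine_family =
  fixes V :: "nat \<Rightarrow> 'a::{real_inner, complete_space} set" and r :: nat
  assumes r: "2 \<le> r"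
    and affine: "\<And>i. i \<in> {1..r} \<Longrightarrow> affine (V i)"
    and closed: "\<And>i. i \<in> {1..r} \<Longrightarrow> closed (V i)"
    and nonempty: "(\<Inter>i\<in>{1..r}. V i) \<noteq> {}"
begin

sublocale directions: closed_subspace_family "\<lambda>i. direction (V i)" r
proof
  obtain v where v: "\<And>i. i \<in> {1..r} \<Longrightarrow> v \<in> V i"
    using nonempty by blast
  show "2 \<le> r" by (rule r)
  show "subspace (direction (V i))" if "i \<in> {1..r}" for i
    using direction_affine(1)[OF affine v] that by blast
  show "closed (direction (V i))" if "i \<in> {1..r}" for i
    using closed_direction[OF affine v closed] that by blast
qed

abbreviation T :: "'a \<Rightarrow> 'a" where "T \<equiv> simultaneous_proj r V"
definition P :: "'a \<Rightarrow> 'a" where "P = metric_proj (\<Inter>i\<in>{1..r}. V i)"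
abbreviation L :: "'a \<Rightarrow> 'a" where "L \<equiv> simultaneous_proj r (\<lambda>i. direction (V i))"

lemma translation_to_directions:
  obtains v where "\<And>x. P x = v + directions.Q (x - v)" "\<And>x. T x = v + L (x - v)"
proof -
  obtain v where v: "\<And>i. i \<in> {1..r} \<Longrightarrow> v \<in> V i"
    using nonempty by blast
  have V: "V i = (+) v ` direction (V i)" if "i \<in> {1..r}" for i
    using direction_affine(2)[OF affine v] that by blast
  have "(\<Inter>i\<in>{1..r}. V i) = (\<Inter>i\<in>{1..r}. (+) v ` direction (V i))"
    using V by (intro INF_cong refl)
  also have "\<dots> = (+) v ` directions.common"
    unfolding directions.common_def
    using r by (intro image_INT[symmetric, where C = UNIV and j = 1]) auto
  finally have P: "P x = v + directions.Q (x - v)" for x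
    using metric_proj_translation[OF directions.subspace_common directions.closed_common] by (simp add: P_def)
  have "metric_proj (V i) x = v + metric_proj (direction (V i)) (x - v)" if i: "i \<in> {1..r}" for i x
    by (subst V[OF i]) (rule metric_proj_translation[OF directions.subspace[OF i] directions.closed[OF i]])
  then have T: "T x = v + L (x - v)" for x
    using r by (simp add: simultaneous_proj_def sum.distrib sum_constant_scaleR scaleR_add_right)
  from that[OF P T] show thesis .
qed

lemma residual_active: "x - P x \<in> directions.active"
proof -
  obtain v where v: "\<And>x. P x = v + directions.Q (x - v)"
    using translation_to_directions by metis
  show ?thesis
    using directions.diff_Q_active[of "x - v"] by (simp add: v algebra_simps)
qed

lemma linear_Q: "linear directions.Q"
  by (rule linear_metric_proj[OF directions.subspace_common directions.closed_common])

lemma Q_common: "z \<in> directions.common \<Longrightarrow> directions.Q z = z"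
  by (rule metric_proj_ident[OF directions.subspace_common])

text \<open>
Every vector \<open>w\<close> of \<open>active\<close> occurs as a residual \<open>x - P x\<close>, for instance at \<open>x = P 0 + w\<close>.
\<close>

lemma P_add_active:
  assumes "w \<in> directions.active"
  shows "P (P x + w) = P x"
proof -
  obtain v where v: "\<And>x. P x = v + directions.Q (x - v)"
    using translation_to_directions by metis
  have "directions.Q w = 0"
    using directions.activeD[OF assms]
    by (intro metric_proj_subspace_eqI directions.subspace_common subspace_0)
       (simp add: inner_commute)
  moreover have "directions.Q (directions.Q (x - v)) = directions.Q (x - v)"
    by (intro Q_common metric_proj_in directions.subspace_common directions.closed_common)
  ultimately show ?thesis
    by (simp add: v linear_add[OF linear_Q])
qed

text \<open>
\<open>x - P x\<close> is the component of \<open>x\<close> in \<open>active\<close>, seen from any common point. All statements on \<open>T\<close> are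
thereby statements on orbits of \<open>L\<close> in \<open>active\<close>.
\<close>

lemma iterate_residual: "(T ^^ k) x - P x = (L ^^ k) (x - P x)"
proof -
  obtain v where v: "\<And>x. P x = v + directions.Q (x - v)" "\<And>x. T x = v + L (x - v)"
    using translation_to_directions by metis
  have Tk: "(T ^^ k) x = v + (L ^^ k) (x - v)"
    by (induction k) (simp_all add: v(2))
  have "L (directions.Q z) = directions.Q z" for z
    unfolding directions.fixed_iff
    by (rule metric_proj_in[OF directions.subspace_common directions.closed_common])
  then have fixed: "(L ^^ k) (directions.Q z) = directions.Q z" for z
    by (induction k) simp_all
  have "x - P x = (x - v) - directions.Q (x - v)"
    by (simp add: v(1))
  then have "(L ^^ k) (x - P x) = (L ^^ k) (x - v) - directions.Q (x - v)"
    by (simp only: directions.pow_diff fixed)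
  then show ?thesis
    by (simp only: Tk v(1) add_diff_cancel_left)
qed

lemma P_affine: "a + b = 1 \<Longrightarrow> P (a *\<^sub>R x + b *\<^sub>R y) = a *\<^sub>R P x + b *\<^sub>R P y"
proof -
  assume ab: "a + b = 1"
  obtain v where v: "\<And>x. P x = v + directions.Q (x - v)"
    using translation_to_directions by metis
  have split: "v = a *\<^sub>R v + b *\<^sub>R v"
    using ab by (simp flip: scaleR_add_left)
  have "a *\<^sub>R x + b *\<^sub>R y - v = a *\<^sub>R (x - v) + b *\<^sub>R (y - v)"
    by (subst split) (simp add: algebra_simps)
  then have "P (a *\<^sub>R x + b *\<^sub>R y) = v + (a *\<^sub>R directions.Q (x - v) + b *\<^sub>R directions.Q (y - v))"
    by (simp only: v linear_add[OF linear_Q] linear_scale[OF linear_Q])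
  also have "\<dots> = a *\<^sub>R P x + b *\<^sub>R P y"
    by (subst split) (simp add: v algebra_simps)
  finally show ?thesis .
qed

lemma iterates_converge: "iterates_converge T P"
  unfolding iterates_converge_def
proof
  fix x
  have "(\<lambda>k. (T ^^ k) x - P x) \<longlonglongrightarrow> 0"
    unfolding iterate_residual by (intro directions.pow_active_tendsto_0 residual_active)
  then show "(\<lambda>k. (T ^^ k) x) \<longlonglongrightarrow> P x"
    by (simp add: LIM_zero_iff)
qed

text \<open>
\<open>x - P 0\<close> is the residual plus \<open>P x - P 0\<close>, and these two are orthogonal.
\<close>

lemma norm_residual_le: "norm (x - P x) \<le> norm (x - P 0)"
proof -
  obtain v where v: "\<And>x. P x = v + directions.Q (x - v)"
    using translation_to_directions by metis
  define z where "z = P x - P 0"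
  have "z = directions.Q (x - v) - directions.Q (0 - v)"
    by (simp add: z_def v)
  then have "z \<in> directions.common"
    using metric_proj_in[OF directions.subspace_common directions.closed_common]
    by (simp only: subspace_diff[OF directions.subspace_common])
  then have "z \<bullet> (x - P x) = 0"
    using residual_active directions.activeD by blast
  then have "(norm (x - P x))\<^sup>2 \<le> (norm ((x - P x) + z))\<^sup>2"
    by (simp add: power2_norm_eq_inner inner_add inner_commute)
  then have "norm (x - P x) \<le> norm ((x - P x) + z)"
    by (rule power2_le_imp_le) simp
  then show ?thesis by (simp add: z_def)
qed

lemma contracts_imp_bound:
  assumes "directions.contracts \<rho>" "0 \<le> \<rho>"
  shows "norm ((T ^^ k) x - P x) \<le> \<rho> ^ k * norm (x - P 0)"
proof -
  have "norm ((T ^^ k) x - P x) \<le> \<rho> ^ k * norm (x - P x)"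
    unfolding iterate_residual by (intro directions.contracts_pow assms residual_active)
  also have "\<dots> \<le> \<rho> ^ k * norm (x - P 0)"
    by (intro mult_left_mono norm_residual_le) (simp add: assms(2))
  finally show ?thesis .
qed

text \<open>
For the inclusion from left to right, take \<open>k = 1\<close> and \<open>x = P 0 + y\<close> with \<open>y\<close> in \<open>active\<close>: then the residual and
\<open>x - P 0\<close> are both equal to \<open>y\<close>.
\<close>

lemma linear_rates_eq: "linear_rates T P = {\<rho>. 0 < \<rho> \<and> \<rho> < 1 \<and> directions.contracts \<rho>}"
proof -
  have "directions.contracts \<rho>" if \<rho>: "\<forall>x k. norm ((T ^^ k) x - P x) \<le> \<rho> ^ k * norm (x - P 0)" for \<rho>
    unfolding directions.contracts_def
  proof
    fix y
    assume y: "y \<in> directions.active"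
    have "norm ((L ^^ 1) ((P 0 + y) - P (P 0 + y))) \<le> \<rho> ^ 1 * norm ((P 0 + y) - P 0)"
      unfolding iterate_residual[symmetric] using \<rho> by blast
    then show "norm (L y) \<le> \<rho> * norm y"
      by (simp add: P_add_active[OF y])
  qed
  then show ?thesis
    unfolding linear_rates_def using contracts_imp_bound by fastforce
qed

lemma converges_linearly:
  assumes "directions.contracts \<rho>" "\<rho> < 1"
  shows "converges_linearly T P"
proof -
  \<comment> \<open>If all V i coincide, L vanishes on active and \<open>\<rho>\<close> may be 0 or negative; a rate must be positive.\<close>
  define q where "q = max \<rho> (1/2)"
  have q: "0 < q" "q < 1" "\<rho> \<le> q"
    using assms(2) by (auto simp: q_def)
  have "directions.contracts q"
    using assms(1) q(3) unfolding directions.contracts_def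
    by (meson mult_right_mono norm_ge_zero order_trans)
  then have "norm ((T ^^ k) x - P x) \<le> 1 * q ^ k * norm (x - P 0)" for k x
    using contracts_imp_bound[of q k x] q by simp
  then show ?thesis
    unfolding converges_linearly_def using iterates_converge q zero_less_one by blast
qed

lemma converges_arbitrarily_slowly:
  assumes "\<And>\<rho>. \<rho> < 1 \<Longrightarrow> \<not> directions.contracts \<rho>"
  shows "converges_arbitrarily_slowly T P"
  unfolding converges_arbitrarily_slowly_def
proof (intro conjI allI impI iterates_converge)
  fix a :: "nat \<Rightarrow> real"
  assume "(\<forall>k. 0 < a k) \<and> a \<longlonglongrightarrow> 0"
  then obtain w where w: "w \<in> directions.active" "\<And>k. a k \<le> norm ((L ^^ k) w)"
    using directions.arbitrarily_slow_orbit[OF assms] by blast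
  then show "\<exists>x. \<forall>k. a k \<le> norm ((T ^^ k) x - P x)"
    unfolding iterate_residual by (intro exI[of _ "P 0 + w"]) (simp add: P_add_active)
qed

text \<open>
\<open>Y\<close> is the set of all points at which the convergence is super-polynomially fast. It is affine because
residuals depend affinely on the point, and dense by perturbing the residual alone.
\<close>

lemma super_polynomial_on_dense_affine_subspace:
  "\<exists>Y. affine Y \<and> closure Y = UNIV \<and> converges_super_polynomially_on Y T P"
proof -
  let ?R = "\<lambda>\<alpha> k x. norm ((T ^^ k) x - P x) / real k powr (- \<alpha>)"
  define Y where "Y = {x. \<forall>\<alpha>>0. (\<lambda>k. ?R \<alpha> k x) \<longlonglongrightarrow> 0}"
  have "a *\<^sub>R x + b *\<^sub>R y \<in> Y" if xy: "x \<in> Y" "y \<in> Y" and ab: "a + b = 1" for a b x y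
    unfolding Y_def
  proof (intro CollectI allI impI)
    fix \<alpha> :: real
    assume \<alpha>: "\<alpha> > 0"
    let ?z = "a *\<^sub>R x + b *\<^sub>R y"
    have res: "(T ^^ k) ?z - P ?z = a *\<^sub>R ((T ^^ k) x - P x) + b *\<^sub>R ((T ^^ k) y - P y)" for k
    proof -
      have "?z - P ?z = a *\<^sub>R (x - P x) + b *\<^sub>R (y - P y)"
        unfolding P_affine[OF ab] by (simp add: algebra_simps)
      then show ?thesis
        by (simp add: iterate_residual linear_add[OF directions.linear_pow]
            linear_scale[OF directions.linear_pow])
    qed
    have bound: "norm (?R \<alpha> k ?z) \<le> \<bar>a\<bar> * ?R \<alpha> k x + \<bar>b\<bar> * ?R \<alpha> k y" for k
    proof -
      have "norm ((T ^^ k) ?z - P ?z) \<le> \<bar>a\<bar> * norm ((T ^^ k) x - P x) + \<bar>b\<bar> * norm ((T ^^ k) y - P y)"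
        unfolding res by (rule order_trans[OF norm_triangle_ineq]) simp
      then have "?R \<alpha> k ?z \<le> (\<bar>a\<bar> * norm ((T ^^ k) x - P x) + \<bar>b\<bar> * norm ((T ^^ k) y - P y)) / real k powr (- \<alpha>)"
        by (rule divide_right_mono) simp
      then show ?thesis by (simp add: add_divide_distrib)
    qed
    have "(\<lambda>k. ?R \<alpha> k x) \<longlonglongrightarrow> 0" "(\<lambda>k. ?R \<alpha> k y) \<longlonglongrightarrow> 0"
      using xy \<alpha> by (simp_all add: Y_def)
    then have "(\<lambda>k. \<bar>a\<bar> * ?R \<alpha> k x + \<bar>b\<bar> * ?R \<alpha> k y) \<longlonglongrightarrow> 0"
      by (intro tendsto_add_zero tendsto_mult_right_zero)
    then show "(\<lambda>k. ?R \<alpha> k ?z) \<longlonglongrightarrow> 0"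
      by (rule Lim_null_comparison[rotated]) (intro always_eventually allI bound)
  qed
  then have "affine Y"
    unfolding affine_def by blast
  moreover have "closure Y = UNIV"
  proof -
    have "\<exists>y\<in>Y. dist y x < e" if e: "0 < e" for x e
    proof -
      obtain w where w: "w \<in> directions.active" "norm (w - (x - P x)) \<le> e / 2"
        "\<And>n. \<exists>D. \<forall>k. norm ((L ^^ (n * k)) w) * sqrt (real k) ^ n \<le> D"
        by (rule directions.rapid_orbit_dense[OF residual_active[of x] half_gt_zero[OF e]], rule that)
      have "P x + w \<in> Y"
        unfolding Y_def iterate_residual
        using directions.super_polynomial_decay[OF w(3)] by (simp add: P_add_active[OF w(1)])
      moreover have "dist (P x + w) x < e"
        using w(2) e by (simp add: dist_norm algebra_simps)
      ultimately show ?thesis by blast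
    qed
    then show ?thesis
      by (auto simp: closure_approachable)
  qed
  moreover have "converges_super_polynomially_on Y T P"
  proof -
    have "Y \<noteq> {}"
      using \<open>closure Y = UNIV\<close> by auto
    then show ?thesis
      unfolding converges_super_polynomially_on_def
      using iterates_converge by (auto simp: Y_def)
  qed
  ultimately show ?thesis by blast
qed

lemma best_rate:
  assumes "i \<in> {1..r}" "j \<in> {1..r}" "V i \<noteq> V j" and \<rho>: "directions.contracts \<rho>" "\<rho> < 1"
  shows "directions.rate \<in> linear_rates T P" "p \<in> linear_rates T P \<Longrightarrow> directions.rate \<le> p"
proof -
  obtain v where v: "\<And>i. i \<in> {1..r} \<Longrightarrow> v \<in> V i"
    using nonempty by blast
  have "V i = (+) v ` direction (V i)" "V j = (+) v ` direction (V j)"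
    using direction_affine(2)[OF affine v] assms(1,2) by blast+
  then have "direction (V i) \<noteq> direction (V j)"
    using assms(3) by metis
  then obtain x where x: "directions.admissible x" "directions.quotient x = 1 / real r"
    using directions.admissible_exists[OF assms(1,2)] by blast
  then have pos: "0 < directions.rate"
    using directions.quotient_le_rate[OF x(1)] r by (simp add: less_le_trans[rotated])
  show "directions.rate \<in> linear_rates T P"
    unfolding linear_rates_eq
    using pos directions.rate_le[OF \<rho>(1) x(1)] \<rho>(2) directions.contracts_rate by simp
  show "directions.rate \<le> p" if "p \<in> linear_rates T P"
    using that directions.rate_le[OF _ x(1)] unfolding linear_rates_eq by blast
qed

end

theorem corollary15:
  fixes V :: "nat \<Rightarrow> 'a::{real_inner, complete_space} set" and r :: nat
  assumes "r \<ge> 2"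
    and "\<And>i. i \<in> {1..r} \<Longrightarrow> affine (V i)"
    and "\<And>i. i \<in> {1..r} \<Longrightarrow> closed (V i)"
    and "(\<Inter>i\<in>{1..r}. V i) \<noteq> {}"
  shows
    "let T = simultaneous_proj r V;
         P = metric_proj (\<Inter>i\<in>{1..r}. V i);
         S = (\<Sum>i=1..r. orthogonal_comp (direction (V i)));
         q = (real r - 1) / real r * friedrichs_number r (\<lambda>i. direction (V i)) + 1 / real r;
         case_i = (closed S \<and> converges_linearly T P \<and>
           ((\<exists>i\<in>{1..r}. \<exists>j\<in>{1..r}. V i \<noteq> V j) \<longrightarrow>
              q \<in> linear_rates T P \<and> (\<forall>p\<in>linear_rates T P. q \<le> p)));
         case_ii = (\<not> closed S \<and> converges_arbitrarily_slowly T P \<and>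
           (\<exists>Y. affine Y \<and> closure Y = UNIV \<and> converges_super_polynomially_on Y T P))
     in (case_i \<and> \<not> case_ii) \<or> (\<not> case_i \<and> case_ii)"
proof -
  interpret affine_family V r
    using assms by unfold_locales
  show ?thesis
  proof (cases "closed directions.complement_sum")
    case True
    then obtain \<rho> where \<rho>: "directions.contracts \<rho>" "\<rho> < 1"
      using directions.closed_complement_sum_iff by blast
    have "directions.rate \<in> linear_rates T P \<and> (\<forall>p\<in>linear_rates T P. directions.rate \<le> p)"
      if "\<exists>i\<in>{1..r}. \<exists>j\<in>{1..r}. V i \<noteq> V j"
      using that best_rate[OF _ _ _ \<rho>] by blast
    with True converges_linearly[OF \<rho>] show ?thesis
      unfolding Let_def directions.rate_def P_def by blast
  next
    case False
    then have "converges_arbitrarily_slowly T P"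
      using directions.closed_complement_sum_iff by (intro converges_arbitrarily_slowly) blast
    with False super_polynomial_on_dense_affine_subspace show ?thesis
      unfolding Let_def P_def by blast
  qed
qed

end
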